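(* Let $n\ge 6$. Among all unbalanced signed complete graphs of order $n$ whose negative edges form a spanning tree, let $\Sigma=(K_n,T^-)$ (with $T$ the spanning tree formed by the negative edges) be one that minimizes the least adjacency eigenvalue $\lambda_n(A(\Sigma))$. Then $T\cong\mathcal{T}_{\lceil n/2\rceil-1,\lfloor n/2\rfloor-1}$.
   Context: A signed graph $\Sigma=(G,\sigma)$ is a simple connected graph $G=(V,E)$ together with $\sigma:E\to\{-1,1\}$; an edge $e$ is negative if $\sigma(e)=-1$. A cycle is positive if it contains an even number of negative edges and negative otherwise; $\Sigma$ is balanced if all its cycles are positive, and unbalanced otherwise. The adjacency matrix $A(\Sigma)$ has $(i,j)$ entry $\sigma(v_iv_j)$ if $v_i\sim v_j$ and $0$ otherwise; its eigenvalues are $\lambda_1(A(\Sigma))\ge\dots\ge\lambda_n(A(\Sigma))$. $(K_n,H^-)$ denotes the signed complete graph on $n$ vertices whose negative edges are exactly the edges of the subgraph $H$. For $a,b\ge 2$, $\mathcal{T}_{a-1,b-1}$ denotes the tree on $a+b$ vertices obtained from the disjoint union of the stars $K_{1,a-1}$ and $K_{1,b-1}$ by adding an edge between a pendent vertex of the first and a pendent vertex of the second. *)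

theory Defs
  imports Complex_Main "Jordan_Normal_Form.Char_Poly"
begin

type_synonym 'a graph = "'a set \<times> 'a set set"
type_synonym 'a sgraph = "'a graph \<times> ('a set \<Rightarrow> int)"

definition simple_graph :: "'a graph \<Rightarrow> bool" where
  "simple_graph G \<longleftrightarrow> finite (fst G) \<and>
     (\<forall>e \<in> snd G. \<exists>u \<in> fst G. \<exists>v \<in> fst G. u \<noteq> v \<and> e = {u, v})"

definition graph_connected :: "'a graph \<Rightarrow> bool" where
  "graph_connected G \<longleftrightarrow> fst G \<noteq> {} \<and>
     (\<forall>u \<in> fst G. \<forall>v \<in> fst G. (u, v) \<in> {(x, y). {x, y} \<in> snd G}\<^sup>*)"

text \<open>A cycle is given by the list of its vertices, without repeating the first one at the end.\<close>

definition cycle_edges :: "'a list \<Rightarrow> 'a set set" where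
  "cycle_edges c = {{c ! i, c ! (Suc i mod length c)} | i. i < length c}"

definition is_cycle :: "'a graph \<Rightarrow> 'a list \<Rightarrow> bool" where
  "is_cycle G c \<longleftrightarrow> length c \<ge> 3 \<and> distinct c \<and> set c \<subseteq> fst G \<and> cycle_edges c \<subseteq> snd G"

definition is_tree :: "'a graph \<Rightarrow> bool" where
  "is_tree T \<longleftrightarrow> simple_graph T \<and> graph_connected T \<and> (\<nexists>c. is_cycle T c)"

definition spanning_tree :: "'a graph \<Rightarrow> 'a graph \<Rightarrow> bool" where
  "spanning_tree G T \<longleftrightarrow> is_tree T \<and> fst T = fst G \<and> snd T \<subseteq> snd G"

definition graph_iso :: "'a graph \<Rightarrow> 'b graph \<Rightarrow> bool" where
  "graph_iso G H \<longleftrightarrow> (\<exists>f. bij_betw f (fst G) (fst H) \<and>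
     (\<forall>u \<in> fst G. \<forall>v \<in> fst G. {u, v} \<in> snd G \<longleftrightarrow> {f u, f v} \<in> snd H))"

definition signed_graph :: "'a sgraph \<Rightarrow> bool" where
  "signed_graph S \<longleftrightarrow> simple_graph (fst S) \<and> graph_connected (fst S) \<and>
     (\<forall>e \<in> snd (fst S). snd S e = 1 \<or> snd S e = -1)"

definition positive_cycle :: "'a sgraph \<Rightarrow> 'a list \<Rightarrow> bool" where
  "positive_cycle S c \<longleftrightarrow> even (card {e \<in> cycle_edges c. snd S e = -1})"

definition balanced :: "'a sgraph \<Rightarrow> bool" where
  "balanced S \<longleftrightarrow> (\<forall>c. is_cycle (fst S) c \<longrightarrow> positive_cycle S c)"

text \<open>The vertices are assumed to be \<open>0, \<dots>, n - 1\<close>, where \<open>n\<close> is the order of the graph.\<close>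

definition adjacency_matrix :: "nat sgraph \<Rightarrow> real mat" where
  "adjacency_matrix S = (let n = card (fst (fst S)) in
     mat n n (\<lambda>(i, j). if {i, j} \<in> snd (fst S) then of_int (snd S {i, j}) else 0))"

text \<open>For a real symmetric matrix of positive size the set below is finite and nonempty and
  contains every eigenvalue, so its minimum is the last one in decreasing order.\<close>

definition least_eigenvalue :: "real mat \<Rightarrow> real" where
  "least_eigenvalue A = Min {k. eigenvalue A k}"

definition complete_graph :: "nat \<Rightarrow> nat graph" where
  "complete_graph n = ({0..<n}, {{u, v} | u v. u < n \<and> v < n \<and> u \<noteq> v})"

text \<open>The signed complete graph \<open>(K\<^sub>n, H\<^sup>-)\<close>.\<close>

definition signed_complete :: "nat \<Rightarrow> nat graph \<Rightarrow> nat sgraph" where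
  "signed_complete n H = (complete_graph n, \<lambda>e. if e \<in> snd H then -1 else 1)"

lemma signed_graph_signed_complete:
  assumes "n \<ge> 1"
  shows "signed_graph (signed_complete n H)"
proof -
  have "(u, v) \<in> {(x, y). {x, y} \<in> snd (complete_graph n)}\<^sup>*" if "u < n" "v < n" for u v
  proof (cases "u = v")
    case False
    then have "{u, v} \<in> snd (complete_graph n)"
      using that by (auto simp: complete_graph_def)
    then show ?thesis by (intro r_into_rtrancl) simp
  qed simp
  then have "graph_connected (complete_graph n)"
    using assms by (auto simp: graph_connected_def complete_graph_def)
  moreover have "simple_graph (complete_graph n)"
    by (fastforce simp: simple_graph_def complete_graph_def)
  ultimately show ?thesis
    by (simp add: signed_graph_def signed_complete_def)
qed

text \<open>The star \<open>K\<^sub>1\<^sub>,\<^sub>p\<close> has centre \<open>0\<close> and leaves \<open>1, \<dots>, p\<close>.\<close>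

definition star :: "nat \<Rightarrow> nat graph" where
  "star p = ({0..p}, {{0, i} | i. 1 \<le> i \<and> i \<le> p})"

definition disjoint_union :: "'a graph \<Rightarrow> 'b graph \<Rightarrow> ('a + 'b) graph" where
  "disjoint_union G H = (fst G <+> fst H, (`) Inl ` snd G \<union> (`) Inr ` snd H)"

text \<open>The tree \<open>\<T>\<^sub>p\<^sub>,\<^sub>q\<close>, for \<open>p, q \<ge> 1\<close>; the vertex \<open>1\<close> is pendent in each star, and by symmetry
  the choice of the pendent vertices does not matter up to isomorphism.\<close>

definition joined_stars :: "nat \<Rightarrow> nat \<Rightarrow> (nat + nat) graph" where
  "joined_stars p q = (let G = disjoint_union (star p) (star q)
     in (fst G, insert {Inl 1, Inr 1} (snd G)))"

end

theory Submission
  imports Defs "HOL-Analysis.Function_Topology" "HOL-Analysis.Convex"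
begin

text \<open>The adjacency matrix is \<open>J - I - 2 A\<^sub>T\<close>, so minimizing the least eigenvalue means maximizing the
  largest value \<open>\<mu>\<close> of \<open>4 \<Sum>\<^bsub>uv \<in> T\<^esub> x\<^sub>u x\<^sub>v - (\<Sum> x\<^sub>v)\<^sup>2\<close> over unit vectors \<open>x\<close>, called \<open>gain_bound\<close> below.
  For an optimal \<open>T\<close> with maximizer \<open>x\<close>, let \<open>P\<close> and \<open>Q\<close> be the vertices of nonnegative and of negative
  weight; both are nonempty, as vectors of constant sign give nonpositive values. A spanning tree of
  greatest weight \<open>\<Sum> x\<^sub>u x\<^sub>v\<close> consists of a star on \<open>P\<close> and a star on \<open>Q\<close>, each centred at a vertex with
  greatest \<open>\<bar>x\<^sub>v\<bar>\<close>, and one edge between the vertices of \<open>P\<close> and \<open>Q\<close> with least \<open>\<bar>x\<^sub>v\<bar>\<close>. So \<open>x\<close> is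
  also an eigenvector of this double star, and the eigenvalue equations show that the maximum is
  strict, whence \<open>T\<close> is the double star itself. For a double star with \<open>p\<close> and \<open>q\<close> free leaves the
  eigenvalue equations reduce to the vanishing of a determinant that, for fixed \<open>p + q\<close> and \<open>\<mu> > 2\<close>,
  is strictly increasing in \<open>p q\<close>; a positive determinant yields a vector exceeding \<open>\<mu>\<close>. Hence the
  two stars are as equal as possible.\<close>

section \<open>Rayleigh quotients and the least eigenvalue\<close>

definition quad_form :: "nat \<Rightarrow> (nat \<Rightarrow> nat \<Rightarrow> real) \<Rightarrow> (nat \<Rightarrow> real) \<Rightarrow> real" where
  "quad_form n a x = (\<Sum>i<n. \<Sum>j<n. a i j * x i * x j)"

lemma quad_form_perturb:
  assumes sym: "\<And>i j. i < n \<Longrightarrow> j < n \<Longrightarrow> a i j = a j i"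
    and k: "k < n"
  shows "quad_form n a (\<lambda>i. x i + (if i = k then h else 0))
    = quad_form n a x + 2 * h * (\<Sum>j<n. a k j * x j) + h\<^sup>2 * a k k"
proof -
  let ?d = "\<lambda>i. if i = k then h else 0"
  have 1: "(\<Sum>i<n. \<Sum>j<n. a i j * x i * ?d j) = h * (\<Sum>i<n. a k i * x i)"
  proof -
    have "(\<Sum>j<n. a i j * x i * ?d j) = h * (a k i * x i)" if "i < n" for i
      using k sym[OF that k] by (subst sum.cong[OF refl, where h = "\<lambda>j. if j = k then a i j * x i * h else 0"]) auto
    then show ?thesis by (simp add: sum_distrib_left)
  qed
  have 2: "(\<Sum>i<n. \<Sum>j<n. a i j * ?d i * x j) = h * (\<Sum>j<n. a k j * x j)"
  proof -
    have "(\<Sum>i<n. \<Sum>j<n. a i j * ?d i * x j) = (\<Sum>i<n. if i = k then (\<Sum>j<n. a k j * h * x j) else 0)"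
      by (intro sum.cong) auto
    also have "\<dots> = h * (\<Sum>j<n. a k j * x j)"
      using k by (simp add: sum_distrib_left mult_ac)
    finally show ?thesis .
  qed
  have 3: "(\<Sum>i<n. \<Sum>j<n. a i j * ?d i * ?d j) = h\<^sup>2 * a k k"
  proof -
    have "(\<Sum>i<n. \<Sum>j<n. a i j * ?d i * ?d j)
        = (\<Sum>i<n. if i = k then (\<Sum>j<n. if j = k then a k k * h * h else 0) else 0)"
      using k by (intro sum.cong refl) (auto simp: if_distrib cong: if_cong)
    also have "\<dots> = h\<^sup>2 * a k k"
      using k by (simp add: power2_eq_square mult_ac)
    finally show ?thesis .
  qed
  have "quad_form n a (\<lambda>i. x i + ?d i) = (\<Sum>i<n. \<Sum>j<n. a i j * x i * x j
      + a i j * x i * ?d j + a i j * ?d i * x j + a i j * ?d i * ?d j)"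
    unfolding quad_form_def by (intro sum.cong refl) (simp only: ring_distribs add_ac mult_ac)
  then show ?thesis
    unfolding sum.distrib 1 2 3 by (simp add: quad_form_def)
qed

lemma quadratic_nonneg_linear_zero:
  fixes g c :: real
  assumes "\<And>h. h * g + h\<^sup>2 * c \<ge> 0"
  shows "g = 0"
proof (rule ccontr)
  assume "g \<noteq> 0"
  \<comment> \<open>Any C that exceeds both 0 and c makes the quadratic negative at h = -g/C, where
    its value is g^2 (c - C) / C^2.\<close>
  define C where "C = \<bar>c\<bar> + 1"
  have C: "C > 0" "c < C" by (auto simp: C_def)
  have "(- g / C) * g + (- g / C)\<^sup>2 * c = g\<^sup>2 * (c - C) / C\<^sup>2"
    using C by (simp add: field_simps power2_eq_square)
  also have "\<dots> < 0"
    using C \<open>g \<noteq> 0\<close> by (intro divide_neg_pos mult_pos_neg) auto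
  finally show False using assms[of "- g / C"] by linarith
qed

text \<open>Perturb \<open>x\<close> in coordinate \<open>k\<close> alone. The form minus
  \<open>l\<close> times the squared norm is nonnegative and vanishes at \<open>x\<close>, so its
  linear term in the perturbation is zero; that term is row \<open>k\<close> of the eigenvalue
  equation.\<close>

lemma rayleigh_minimizer_eigen:
  assumes sym: "\<And>i j. i < n \<Longrightarrow> j < n \<Longrightarrow> a i j = a j i"
    and bound: "\<And>y. l * (\<Sum>i<n. (y i)\<^sup>2) \<le> quad_form n a y"
    and eq: "quad_form n a x = l * (\<Sum>i<n. (x i)\<^sup>2)"
    and k: "k < n"
  shows "(\<Sum>j<n. a k j * x j) = l * x k"
proof -
  have "h * (2 * ((\<Sum>j<n. a k j * x j) - l * x k)) + h\<^sup>2 * (a k k - l) \<ge> 0" for h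
  proof -
    let ?y = "\<lambda>i. x i + (if i = k then h else 0)"
    have "(\<Sum>i<n. (?y i)\<^sup>2) = (\<Sum>i<n. (x i)\<^sup>2 + (if i = k then 2 * h * x k + h\<^sup>2 else 0))"
      by (intro sum.cong) (auto simp: power2_eq_square algebra_simps)
    also have "\<dots> = (\<Sum>i<n. (x i)\<^sup>2) + (2 * h * x k + h\<^sup>2)"
      using k by (simp add: sum.distrib)
    finally show ?thesis
      using bound[of ?y] quad_form_perturb[of n a k x h, OF sym k] eq
      by (simp add: algebra_simps)
  qed
  from quadratic_nonneg_linear_zero[OF this] show ?thesis by simp
qed

text \<open>The unit sphere is compact and the form continuous; homogeneity carries the bound to all
  vectors. Vectors are functions on all of \<open>nat\<close>, so the sphere is cut out of a product
  of intervals with the coordinates from \<open>n\<close> on pinned to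
  \<open>undefined\<close>.\<close>

lemma rayleigh_minimizer_exists:
  assumes "n > 0"
  obtains l x where "\<And>y. l * (\<Sum>i<n. (y i)\<^sup>2) \<le> quad_form n a y"
    "quad_form n a x = l * (\<Sum>i<n. (x i)\<^sup>2)" "(\<Sum>i<n. (x i)\<^sup>2) = 1"
proof -
  define B where "B = PiE {..<n} (\<lambda>_. {-1..1::real})"
  define S where "S = {x \<in> B. (\<Sum>i<n. (x i)\<^sup>2) = 1}"
  \<comment> \<open>Written over all indices, with singleton factors from \<open>n\<close> on,
    \<open>B\<close> is a full product of compact sets, to which Tychonoff's theorem
    applies.\<close>
  have B: "B = PiE UNIV (\<lambda>i. if i < n then {-1..1} else {undefined})"
    by (auto simp: B_def PiE_def Pi_def extensional_def split: if_splits)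
  have "compact B"
    unfolding B compactin_euclidean_iff[symmetric] euclidean_product_topology[symmetric]
    by (subst compactin_PiE) auto
  have coord: "continuous_on U (\<lambda>x::nat \<Rightarrow> real. x i)" for U i
    by (rule continuous_on_subset[OF continuous_on_product_coordinates]) simp
  have "closed {x::nat \<Rightarrow> real. (\<Sum>i<n. (x i)\<^sup>2) = 1}"
    by (intro closed_Collect_eq continuous_intros coord)
  with \<open>compact B\<close> have "compact S"
    unfolding S_def by (metis (no_types) Collect_conj_eq Collect_mem_eq compact_Int_closed)
  have norm: "(\<lambda>i. if i < n then y i / sqrt (\<Sum>i<n. (y i)\<^sup>2) else undefined) \<in> S"
    if "(\<Sum>i<n. (y i)\<^sup>2) \<noteq> 0" for y
  proof -
    let ?s = "\<Sum>i<n. (y i)\<^sup>2"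
    have "?s \<ge> 0" by (intro sum_nonneg) auto
    then have s: "?s > 0" using that by simp
    have "\<bar>y i\<bar> \<le> sqrt ?s" if "i < n" for i
      using that by (intro real_le_rsqrt) (simp add: member_le_sum[of i "{..<n}" "\<lambda>i. (y i)\<^sup>2"])
    then have "\<bar>y i / sqrt ?s\<bar> \<le> 1" if "i < n" for i
      using that s by (simp add: abs_div)
    then have "y i / sqrt ?s \<in> {-1..1}" if "i < n" for i
      using that by (metis abs_le_iff atLeastAtMost_iff minus_le_iff)
    moreover have "(\<Sum>i<n. (y i / sqrt ?s)\<^sup>2) = 1"
      using s by (simp add: power_divide sum_divide_distrib[symmetric])
    ultimately show ?thesis
      unfolding S_def B_def by (auto simp: PiE_def extensional_def)
  qed
  have "(\<Sum>i<n. ((if i = 0 then 1 else 0)::real)\<^sup>2) = 1"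
    using assms by (simp add: if_distrib[of "\<lambda>t. t\<^sup>2"] cong: if_cong)
  then have "S \<noteq> {}" using norm[of "\<lambda>i. if i = 0 then 1 else 0"] by auto
  moreover have "continuous_on S (quad_form n a)"
    unfolding quad_form_def by (intro continuous_intros coord)
  ultimately obtain x where x: "x \<in> S" "\<And>y. y \<in> S \<Longrightarrow> quad_form n a x \<le> quad_form n a y"
    using continuous_attains_inf[OF \<open>compact S\<close>] by blast
  show ?thesis
  proof
    fix y :: "nat \<Rightarrow> real"
    let ?s = "\<Sum>i<n. (y i)\<^sup>2"
    show "quad_form n a x * ?s \<le> quad_form n a y"
    proof (cases "?s = 0")
      case True
      then have "\<forall>i<n. y i = 0" by (subst (asm) sum_nonneg_eq_0_iff) auto
      then show ?thesis using True by (simp add: quad_form_def)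
    next
      case False
      have "?s \<ge> 0" by (intro sum_nonneg) auto
      then have s: "?s > 0" using False by simp
      have "quad_form n a x \<le> quad_form n a (\<lambda>i. if i < n then y i / sqrt ?s else undefined)"
        using norm[OF False] x(2) by blast
      also have "\<dots> = (\<Sum>i<n. \<Sum>j<n. a i j * y i * y j / ?s)"
        unfolding quad_form_def using s by (intro sum.cong refl) (simp add: field_simps)
      also have "\<dots> = quad_form n a y / ?s"
        by (simp add: quad_form_def sum_divide_distrib)
      finally show ?thesis using s by (simp add: field_simps)
    qed
  next
    show "quad_form n a x = quad_form n a x * (\<Sum>i<n. (x i)\<^sup>2)" "(\<Sum>i<n. (x i)\<^sup>2) = 1"
      using x(1) by (simp_all add: S_def)
  qed
qed

lemma quad_form_mat_mult:
  assumes "A \<in> carrier_mat n n" "v \<in> carrier_vec n"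
  shows "quad_form n (\<lambda>i j. A $$ (i, j)) (\<lambda>i. v $ i) = v \<bullet> (A *\<^sub>v v)"
  using assms by (auto simp: quad_form_def scalar_prod_def sum_distrib_left atLeast0LessThan
      mult_ac intro!: sum.cong)

text \<open>The Rayleigh minimum \<open>l\<close> is an eigenvalue, since a minimizer is an
  eigenvector, and every eigenvalue is the Rayleigh quotient of its own eigenvector, hence at least
  \<open>l\<close>.\<close>

lemma least_eigenvalue_rayleigh:
  assumes A: "A \<in> carrier_mat n n" and "n > 0"
    and sym: "\<And>i j. i < n \<Longrightarrow> j < n \<Longrightarrow> A $$ (i, j) = A $$ (j, i)"
  shows least_eigenvalue_le:
      "least_eigenvalue A * (\<Sum>i<n. (y i)\<^sup>2) \<le> quad_form n (\<lambda>i j. A $$ (i, j)) y"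
    and least_eigenvalue_attained:
      "\<exists>x. quad_form n (\<lambda>i j. A $$ (i, j)) x = least_eigenvalue A * (\<Sum>i<n. (x i)\<^sup>2)
        \<and> (\<Sum>i<n. (x i)\<^sup>2) = 1"
proof -
  let ?q = "quad_form n (\<lambda>i j. A $$ (i, j))"
  obtain l x where l: "\<And>y. l * (\<Sum>i<n. (y i)\<^sup>2) \<le> ?q y"
    and x: "?q x = l * (\<Sum>i<n. (x i)\<^sup>2)" "(\<Sum>i<n. (x i)\<^sup>2) = 1"
    using rayleigh_minimizer_exists[OF \<open>n > 0\<close>] by metis
  have "eigenvector A (vec n x) l"
  proof -
    have "A *\<^sub>v vec n x = l \<cdot>\<^sub>v vec n x"
    proof (rule eq_vecI)
      fix k assume "k < dim_vec (l \<cdot>\<^sub>v vec n x)"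
      then have k: "k < n" by simp
      then have "(A *\<^sub>v vec n x) $ k = (\<Sum>j<n. A $$ (k, j) * x j)"
        using A by (auto simp: scalar_prod_def atLeast0LessThan intro!: sum.cong)
      also have "\<dots> = l * x k"
        by (rule rayleigh_minimizer_eigen[OF sym l x(1) k])
      finally show "(A *\<^sub>v vec n x) $ k = (l \<cdot>\<^sub>v vec n x) $ k" using k by simp
    qed (use A in auto)
    moreover have "vec n x \<noteq> 0\<^sub>v n"
    proof
      assume "vec n x = 0\<^sub>v n"
      then have "\<forall>i<n. x i = 0" by (metis index_vec index_zero_vec(1))
      then show False using x(2) by simp
    qed
    ultimately show ?thesis using A by (auto simp: eigenvector_def)
  qed
  then have l_in: "l \<in> {k. eigenvalue A k}" by (auto simp: eigenvalue_def)
  \<comment> \<open>Finiteness gives \<open>Min\<close> its meaning: the eigenvalues are the roots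
    of the monic characteristic polynomial.\<close>
  have fin: "finite {k. eigenvalue A k}"
    using poly_roots_finite[of "char_poly A"] degree_monic_char_poly[OF A]
    unfolding eigenvalue_root_char_poly[OF A] by force
  have "l \<le> k" if ev: "eigenvalue A k" for k
  proof -
    obtain v where v: "v \<in> carrier_vec n" "v \<noteq> 0\<^sub>v n" "A *\<^sub>v v = k \<cdot>\<^sub>v v"
      using ev A by (auto simp: eigenvalue_def eigenvector_def)
    have "?q (\<lambda>i. v $ i) = k * (\<Sum>i<n. (v $ i)\<^sup>2)"
      using v by (simp add: quad_form_mat_mult[OF A v(1)])
        (simp add: scalar_prod_def power2_eq_square atLeast0LessThan)
    then have "l * (\<Sum>i<n. (v $ i)\<^sup>2) \<le> k * (\<Sum>i<n. (v $ i)\<^sup>2)" using l[of "\<lambda>i. v $ i"] by simp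
    moreover have "(\<Sum>i<n. (v $ i)\<^sup>2) > 0"
    proof -
      obtain i where "i < n" "v $ i \<noteq> 0"
        using v(1,2) by (metis carrier_vecD eq_vecI index_zero_vec)
      then show ?thesis by (intro sum_pos2[of _ i]) auto
    qed
    ultimately show ?thesis by simp
  qed
  then have le: "least_eigenvalue A = l"
    unfolding least_eigenvalue_def using l_in fin by (intro Min_eqI) auto
  show "least_eigenvalue A * (\<Sum>i<n. (y i)\<^sup>2) \<le> ?q y" using l by (simp add: le)
  show "\<exists>x. ?q x = least_eigenvalue A * (\<Sum>i<n. (x i)\<^sup>2) \<and> (\<Sum>i<n. (x i)\<^sup>2) = 1"
    unfolding le using x by blast
qed

section \<open>The quadratic form of a signed complete graph\<close>

definition signed_entry :: "nat set set \<Rightarrow> nat \<Rightarrow> nat \<Rightarrow> real" where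
  "signed_entry E i j = (if i = j then 0 else if {i, j} \<in> E then -1 else 1)"

text \<open>For an edge with two distinct ends, \<open>prod x e\<close> is the product of the
  weights of its ends, so no orientation has to be chosen.\<close>

definition gain :: "nat \<Rightarrow> nat set set \<Rightarrow> (nat \<Rightarrow> real) \<Rightarrow> real" where
  "gain n E x = 4 * (\<Sum>e\<in>E. prod x e) - (\<Sum>i<n. x i)\<^sup>2"

text \<open>The shift by 1 comes from the zero diagonal, that is, from the summand -I of the matrix.
  \<open>gain_le\<close> and \<open>gain_attained\<close> show that this is the maximum of
  \<open>gain\<close> on the unit sphere.\<close>

definition gain_bound :: "nat \<Rightarrow> nat graph \<Rightarrow> real" where
  "gain_bound n T = - 1 - least_eigenvalue (adjacency_matrix (signed_complete n T))"

lemma adjacency_matrix_signed_complete: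
  shows "adjacency_matrix (signed_complete n T) \<in> carrier_mat n n"
    and "i < n \<Longrightarrow> j < n \<Longrightarrow>
      adjacency_matrix (signed_complete n T) $$ (i, j) = signed_entry (snd T) i j"
  by (auto simp: adjacency_matrix_def signed_complete_def complete_graph_def Let_def
      signed_entry_def doubleton_eq_iff)

lemma signed_entry_sym: "signed_entry E i j = signed_entry E j i"
  by (simp add: signed_entry_def insert_commute)

text \<open>Each edge is met by exactly two ordered pairs of vertices.\<close>

lemma edge_double_sum:
  fixes x :: "nat \<Rightarrow> real"
  assumes E: "E \<subseteq> snd (complete_graph n)"
  shows "(\<Sum>i<n. \<Sum>j<n. (if i \<noteq> j \<and> {i, j} \<in> E then x i * x j else 0)) = 2 * (\<Sum>e\<in>E. prod x e)"
proof -
  have "E \<subseteq> Pow {..<n}" using E by (auto simp: complete_graph_def)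
  then have fin: "finite E" by (rule finite_subset) simp
  have one: "(\<Sum>i<n. \<Sum>j<n. (if i \<noteq> j \<and> {i, j} = e then x i * x j else 0)) = 2 * prod x e"
    if e: "e \<in> E" for e
  proof -
    obtain u v where uv: "u < n" "v < n" "u \<noteq> v" "e = {u, v}"
      using e E by (auto simp: complete_graph_def)
    have "(\<Sum>i<n. \<Sum>j<n. (if i \<noteq> j \<and> {i, j} = e then x i * x j else 0))
        = (\<Sum>i<n. \<Sum>j<n. (if i = u then (if j = v then x u * x v else 0) else 0)
            + (if i = v then (if j = u then x u * x v else 0) else 0))"
      using uv by (intro sum.cong refl) (auto simp: doubleton_eq_iff)
    also have "\<dots> = (\<Sum>i<n. (if i = u then (\<Sum>j<n. if j = v then x u * x v else 0) else 0)
            + (if i = v then (\<Sum>j<n. if j = u then x u * x v else 0) else 0))"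
      by (intro sum.cong refl) (auto simp: sum.distrib)
    also have "\<dots> = 2 * (x u * x v)" using uv by (simp add: sum.distrib)
    finally show ?thesis using uv by simp
  qed
  have "(\<Sum>i<n. \<Sum>j<n. (if i \<noteq> j \<and> {i, j} \<in> E then x i * x j else 0))
      = (\<Sum>i<n. \<Sum>j<n. \<Sum>e\<in>E. (if i \<noteq> j \<and> {i, j} = e then x i * x j else 0))"
  proof (intro sum.cong refl)
    fix i j
    show "(if i \<noteq> j \<and> {i, j} \<in> E then x i * x j else 0)
        = (\<Sum>e\<in>E. (if i \<noteq> j \<and> {i, j} = e then x i * x j else 0))"
    proof (cases "i \<noteq> j \<and> {i, j} \<in> E")
      case False
      then have "(\<Sum>e\<in>E. (if i \<noteq> j \<and> {i, j} = e then x i * x j else 0)) = 0"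
        by (intro sum.neutral) auto
      then show ?thesis using False by auto
    qed (simp add: fin)
  qed
  also have "\<dots> = (\<Sum>i<n. \<Sum>e\<in>E. \<Sum>j<n. (if i \<noteq> j \<and> {i, j} = e then x i * x j else 0))"
    by (intro sum.cong refl sum.swap)
  also have "\<dots> = (\<Sum>e\<in>E. \<Sum>i<n. \<Sum>j<n. (if i \<noteq> j \<and> {i, j} = e then x i * x j else 0))"
    by (rule sum.swap)
  also have "\<dots> = (\<Sum>e\<in>E. 2 * prod x e)" using one by (intro sum.cong refl)
  finally show ?thesis by (simp add: sum_distrib_left)
qed

lemma quad_form_signed_entry:
  assumes E: "E \<subseteq> snd (complete_graph n)"
  shows "quad_form n (signed_entry E) x = - gain n E x - (\<Sum>i<n. (x i)\<^sup>2)"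
proof -
  have "quad_form n (signed_entry E) x = (\<Sum>i<n. \<Sum>j<n. x i * x j - (if i = j then x i * x j else 0)
      - 2 * (if i \<noteq> j \<and> {i, j} \<in> E then x i * x j else 0))"
    unfolding quad_form_def by (intro sum.cong refl) (auto simp: signed_entry_def)
  also have "\<dots> = (\<Sum>i<n. \<Sum>j<n. x i * x j) - (\<Sum>i<n. \<Sum>j<n. (if i = j then x i * x j else 0))
      - 2 * (\<Sum>i<n. \<Sum>j<n. (if i \<noteq> j \<and> {i, j} \<in> E then x i * x j else 0))"
    by (simp add: sum_subtractf sum_distrib_left)
  also have "(\<Sum>i<n. \<Sum>j<n. x i * x j) = (\<Sum>i<n. x i)\<^sup>2"
    by (simp add: power2_eq_square sum_product)
  also have "(\<Sum>i<n. \<Sum>j<n. (if i = j then x i * x j else 0)) = (\<Sum>i<n. (x i)\<^sup>2)"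
    by (simp add: power2_eq_square)
  finally show ?thesis unfolding edge_double_sum[OF E] gain_def by simp
qed

lemma signed_entry_row:
  assumes "k < n" "{k} \<notin> E"
  shows "(\<Sum>j<n. signed_entry E k j * x j)
    = (\<Sum>j<n. x j) - x k - 2 * (\<Sum>j | j < n \<and> {k, j} \<in> E. x j)"
proof -
  have "(\<Sum>j<n. signed_entry E k j * x j)
      = (\<Sum>j<n. x j - (if k = j then x j else 0) - 2 * (if {k, j} \<in> E then x j else 0))"
    using assms by (intro sum.cong refl) (auto simp: signed_entry_def)
  also have "\<dots> = (\<Sum>j<n. x j) - x k - 2 * (\<Sum>j<n. if {k, j} \<in> E then x j else 0)"
    using assms(1) by (simp add: sum_subtractf sum_distrib_left)
  also have "(\<Sum>j<n. if {k, j} \<in> E then x j else 0) = (\<Sum>j | j < n \<and> {k, j} \<in> E. x j)"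
    by (simp add: sum.inter_filter[symmetric] lessThan_def)
  finally show ?thesis .
qed

context
  fixes n :: nat and T :: "nat graph"
  assumes n: "n > 0" and T: "snd T \<subseteq> snd (complete_graph n)"
begin

private lemma quad_form_adjacency:
  "quad_form n (\<lambda>i j. adjacency_matrix (signed_complete n T) $$ (i, j)) x
    = - gain n (snd T) x - (\<Sum>i<n. (x i)\<^sup>2)"
proof -
  have "quad_form n (\<lambda>i j. adjacency_matrix (signed_complete n T) $$ (i, j)) x
      = quad_form n (signed_entry (snd T)) x"
    by (simp add: quad_form_def adjacency_matrix_signed_complete)
  then show ?thesis by (simp add: quad_form_signed_entry[OF T])
qed

lemma gain_le: "gain n (snd T) x \<le> gain_bound n T * (\<Sum>i<n. (x i)\<^sup>2)"
  using least_eigenvalue_le[OF adjacency_matrix_signed_complete(1) n, of T x]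
  by (simp add: quad_form_adjacency gain_bound_def adjacency_matrix_signed_complete
      signed_entry_sym algebra_simps)

lemma gain_attained:
  obtains x where "gain n (snd T) x = gain_bound n T * (\<Sum>i<n. (x i)\<^sup>2)" "(\<Sum>i<n. (x i)\<^sup>2) = 1"
proof -
  have "\<exists>x. quad_form n (\<lambda>i j. adjacency_matrix (signed_complete n T) $$ (i, j)) x
      = least_eigenvalue (adjacency_matrix (signed_complete n T)) * (\<Sum>i<n. (x i)\<^sup>2)
        \<and> (\<Sum>i<n. (x i)\<^sup>2) = 1"
    by (rule least_eigenvalue_attained[OF adjacency_matrix_signed_complete(1) n])
      (simp add: adjacency_matrix_signed_complete signed_entry_sym)
  then obtain x where "- gain n (snd T) x - (\<Sum>i<n. (x i)\<^sup>2)
      = least_eigenvalue (adjacency_matrix (signed_complete n T)) * (\<Sum>i<n. (x i)\<^sup>2)"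
    "(\<Sum>i<n. (x i)\<^sup>2) = 1"
    unfolding quad_form_adjacency by blast
  then show ?thesis by (intro that[of x]) (auto simp: gain_bound_def)
qed

text \<open>Equality in \<open>gain_le\<close> makes \<open>x\<close> a Rayleigh minimizer of the
  signed matrix for the value \<open>- 1 - gain_bound n T\<close>; the claim is row \<open>k\<close>
  of its eigenvalue equation, rewritten through the negative edges.\<close>

lemma gain_eq_eigen:
  assumes eq: "gain n (snd T) x = gain_bound n T * (\<Sum>i<n. (x i)\<^sup>2)" and k: "k < n"
  shows "gain_bound n T * x k = 2 * (\<Sum>j | j < n \<and> {k, j} \<in> snd T. x j) - (\<Sum>j<n. x j)"
proof -
  have "{k} \<notin> snd T" using T by (auto simp: complete_graph_def)
  have "(\<Sum>j<n. signed_entry (snd T) k j * x j) = (- 1 - gain_bound n T) * x k"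
  proof (rule rayleigh_minimizer_eigen[OF signed_entry_sym _ _ k])
    show "(- 1 - gain_bound n T) * (\<Sum>i<n. (y i)\<^sup>2) \<le> quad_form n (signed_entry (snd T)) y" for y
      using gain_le[of y] by (simp add: quad_form_signed_entry[OF T] algebra_simps)
    show "quad_form n (signed_entry (snd T)) x = (- 1 - gain_bound n T) * (\<Sum>i<n. (x i)\<^sup>2)"
      using eq by (simp add: quad_form_signed_entry[OF T] algebra_simps)
  qed
  then show ?thesis
    unfolding signed_entry_row[OF k \<open>{k} \<notin> snd T\<close>] by (simp add: algebra_simps)
qed

end

section \<open>Weights of forests\<close>

text \<open>Connectedness is left out on purpose: the edges of a tree that lie inside one sign class
  form only a forest on that class.\<close>

definition acyclic_edges :: "'a set \<Rightarrow> 'a set set \<Rightarrow> bool" where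
  "acyclic_edges V E \<longleftrightarrow> (\<nexists>c. is_cycle (V, E) c)"

lemma acyclic_edges_mono:
  assumes "acyclic_edges V E" "W \<subseteq> V" "F \<subseteq> E"
  shows "acyclic_edges W F"
  using assms unfolding acyclic_edges_def is_cycle_def by fastforce

text \<open>The predecessor and the successor of \<open>v\<close> on the cycle differ because the
  length is at least three. Hence a vertex with a single neighbour lies on no cycle.\<close>

lemma cycle_two_neighbours:
  assumes "is_cycle G c" "v \<in> set c"
  obtains u w where "u \<in> set c" "w \<in> set c" "u \<noteq> w" "{v, u} \<in> snd G" "{v, w} \<in> snd G"
proof -
  let ?n = "length c"
  have c: "?n \<ge> 3" "distinct c" "cycle_edges c \<subseteq> snd G"
    using assms by (auto simp: is_cycle_def)
  obtain i where i: "i < ?n" "v = c ! i" using assms(2) by (auto simp: in_set_conv_nth)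
  have edge: "{c ! j, c ! (Suc j mod ?n)} \<in> snd G" if "j < ?n" for j
    using that c(3) by (auto simp: cycle_edges_def)
  \<comment> \<open>Index of the predecessor, wrapping round to the last position when
    \<open>i = 0\<close>.\<close>
  define j where "j = (if i = 0 then ?n - 1 else i - 1)"
  have j: "j < ?n" "Suc j mod ?n = i" "j \<noteq> Suc i mod ?n"
    using i c(1) by (auto simp: j_def mod_Suc)
  have n: "Suc i mod ?n < ?n" using c(1) by (intro mod_less_divisor) linarith
  show ?thesis
  proof
    show "c ! (Suc i mod ?n) \<noteq> c ! j"
      using j n c(2) by (auto simp: nth_eq_iff_index_eq)
    show "{v, c ! (Suc i mod ?n)} \<in> snd G" using edge[OF i(1)] i(2) by simp
    show "{v, c ! j} \<in> snd G" using edge[OF j(1)] i(2) j(2) by (simp add: insert_commute)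
  qed (use j(1) n in auto)
qed

section \<open>Longest paths, leaves and orientations of forests\<close>

definition is_path :: "'a set set \<Rightarrow> 'a list \<Rightarrow> bool" where
  "is_path E p \<longleftrightarrow> distinct p \<and> (\<forall>i. Suc i < length p \<longrightarrow> {p ! i, p ! Suc i} \<in> E)"

lemma is_path_rev:
  assumes "is_path E p" shows "is_path E (rev p)"
  unfolding is_path_def
proof (intro conjI allI impI)
  show "distinct (rev p)" using assms by (simp add: is_path_def)
  fix i assume "Suc i < length (rev p)"
  then have i: "Suc i < length p" by simp
  then have "{p ! (length p - Suc (Suc i)), p ! Suc (length p - Suc (Suc i))} \<in> E"
    using assms by (auto simp: is_path_def)
  moreover have "Suc (length p - Suc (Suc i)) = length p - Suc i" using i by simp
  ultimately show "{rev p ! i, rev p ! Suc i} \<in> E"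
    using i by (simp add: rev_nth insert_commute)
qed

text \<open>From the start of a longest path, an edge to a vertex off the path would prolong it, and
  an edge to a vertex beyond the second would close a cycle.\<close>

lemma maximal_path_start:
  assumes ac: "acyclic_edges V E" and E: "\<And>e. e \<in> E \<Longrightarrow> e \<subseteq> V"
    and p: "is_path E p" "length p \<ge> 2" "set p \<subseteq> V"
    and max: "\<And>q. is_path E q \<Longrightarrow> set q \<subseteq> V \<Longrightarrow> length q \<le> length p"
    and w: "{p ! 0, w} \<in> E" "w \<noteq> p ! 0"
  shows "w = p ! 1"
proof (rule ccontr)
  assume neq: "w \<noteq> p ! 1"
  have wV: "w \<in> V" using E[OF w(1)] by simp
  show False
  proof (cases "w \<in> set p")
    case False
    have "is_path E (w # p)"
      unfolding is_path_def
    proof (intro conjI allI impI)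
      show "distinct (w # p)" using False p(1) by (simp add: is_path_def)
      fix i assume "Suc i < length (w # p)"
      then show "{(w # p) ! i, (w # p) ! Suc i} \<in> E"
        using w(1) p(1) by (cases i) (auto simp: is_path_def insert_commute)
    qed
    then have "length (w # p) \<le> length p" using wV p(3) by (intro max) auto
    then show False by simp
  next
    case True
    then obtain i where i: "i < length p" "w = p ! i" by (auto simp: in_set_conv_nth)
    have i2: "i \<ge> 2" using i w(2) neq by (metis One_nat_def less_2_cases not_less)
    \<comment> \<open>The prefix ending in \<open>w\<close> has at least three vertices, as i \<ge>
      2, and the edge from \<open>w\<close> back to the start closes it to a cycle.\<close>
    let ?c = "take (Suc i) p"
    have len: "length ?c = Suc i" using i by simp
    have "cycle_edges ?c \<subseteq> E"
    proof
      fix e assume "e \<in> cycle_edges ?c"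
      then obtain j where j: "j < Suc i" "e = {?c ! j, ?c ! (Suc j mod Suc i)}"
        unfolding cycle_edges_def len by blast
      show "e \<in> E"
      proof (cases "j = i")
        case True
        then show ?thesis using j i w(1) by (simp add: insert_commute)
      next
        case False
        then have "Suc j < Suc i" using j by simp
        then show ?thesis using j i p(1) by (auto simp: is_path_def)
      qed
    qed
    moreover have "distinct ?c" "set ?c \<subseteq> V"
      using p(1,3) set_take_subset[of "Suc i" p] by (auto simp: is_path_def)
    ultimately have "is_cycle (V, E) ?c" using len i2 by (simp add: is_cycle_def)
    then show False using ac by (auto simp: acyclic_edges_def)
  qed
qed

text \<open>Both ends of a longest path are leaves, and as they differ, one of them is not
  \<open>r\<close>. Avoiding \<open>r\<close> makes it possible to use \<open>r\<close> as a
  root.\<close>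

lemma acyclic_edges_leaf:
  assumes ac: "acyclic_edges V E" and V: "finite V"
    and E: "\<And>e. e \<in> E \<Longrightarrow> \<exists>u\<in>V. \<exists>v\<in>V. u \<noteq> v \<and> e = {u, v}"
    and ne: "E \<noteq> {}"
  shows "\<exists>v e. v \<noteq> r \<and> e \<in> E \<and> v \<in> e \<and> (\<forall>e'\<in>E. v \<in> e' \<longrightarrow> e' = e)"
proof -
  have EV: "e \<subseteq> V" if "e \<in> E" for e using E[OF that] by auto
  obtain e0 where "e0 \<in> E" using ne by blast
  then obtain a b where ab: "a \<in> V" "b \<in> V" "a \<noteq> b" "{a, b} \<in> E" using E by metis
  define Q where "Q = {p. is_path E p \<and> set p \<subseteq> V}"
  have "length p \<le> card V" if "p \<in> Q" for p
  proof -
    have "distinct p" "set p \<subseteq> V" using that by (auto simp: Q_def is_path_def)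
    then show ?thesis using card_mono[OF V, of "set p"] by (simp add: distinct_card)
  qed
  then have bound: "\<forall>p. p \<in> Q \<longrightarrow> length p < Suc (card V)" by (simp add: less_Suc_eq_le)
  have abQ: "[a, b] \<in> Q" using ab by (auto simp: Q_def is_path_def)
  obtain p where p: "p \<in> Q" "\<And>q. q \<in> Q \<Longrightarrow> length q \<le> length p"
    using ex_has_greatest_nat[of "\<lambda>p. p \<in> Q", OF abQ bound] by blast
  have len: "length p \<ge> 2" using p(2)[OF abQ] by simp
  have leaf: "\<exists>e\<in>E. q ! 0 \<in> e \<and> (\<forall>e'\<in>E. q ! 0 \<in> e' \<longrightarrow> e' = e)" if q: "q \<in> Q" "length q = length p" for q
  proof
    show "{q ! 0, q ! 1} \<in> E" using q len by (auto simp: Q_def is_path_def)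
    show "q ! 0 \<in> {q ! 0, q ! 1} \<and> (\<forall>e'\<in>E. q ! 0 \<in> e' \<longrightarrow> e' = {q ! 0, q ! 1})"
    proof (intro conjI ballI impI)
      fix e assume e: "e \<in> E" "q ! 0 \<in> e"
      obtain u v where uv: "u \<noteq> v" "e = {u, v}" using E[OF e(1)] by metis
      then have "q ! 0 = u \<or> q ! 0 = v" using e(2) by simp
      then obtain w where w: "e = {q ! 0, w}" "w \<noteq> q ! 0" using uv by (metis insert_commute)
      have "w = q ! 1"
      proof (rule maximal_path_start[OF ac])
        show "e' \<subseteq> V" if "e' \<in> E" for e' using EV[OF that] .
        show "is_path E q" "set q \<subseteq> V" "2 \<le> length q" using q len by (auto simp: Q_def)
        show "length q' \<le> length q" if "is_path E q'" "set q' \<subseteq> V" for q'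
          using p(2)[of q'] that q(2) by (simp add: Q_def)
        show "{q ! 0, w} \<in> E" using e(1) w(1) by simp
        show "w \<noteq> q ! 0" by (rule w(2))
      qed
      then show "e = {q ! 0, q ! 1}" using w by simp
    qed simp
  qed
  have rp: "rev p \<in> Q" using p(1) by (auto simp: Q_def is_path_rev)
  have "distinct p" using p(1) by (simp add: Q_def is_path_def)
  then have "p ! 0 \<noteq> p ! (length p - 1)" using len by (subst nth_eq_iff_index_eq) auto
  then have "p ! 0 \<noteq> rev p ! 0" using len by (subst rev_nth) auto
  then have "p ! 0 \<noteq> r \<or> rev p ! 0 \<noteq> r" by auto
  moreover have "\<exists>e\<in>E. p ! 0 \<in> e \<and> (\<forall>e'\<in>E. p ! 0 \<in> e' \<longrightarrow> e' = e)" by (rule leaf[OF p(1) refl])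
  moreover have "\<exists>e\<in>E. rev p ! 0 \<in> e \<and> (\<forall>e'\<in>E. rev p ! 0 \<in> e' \<longrightarrow> e' = e)"
    by (rule leaf[OF rp length_rev])
  ultimately show ?thesis by blast
qed

text \<open>Orienting a forest away from a root \<open>r\<close> of one of its components, every edge has its own
  lower endpoint, and this is never \<open>r\<close>.\<close>

lemma acyclic_edges_orientation:
  assumes ac: "acyclic_edges V E" and V: "finite V"
    and E: "\<And>e. e \<in> E \<Longrightarrow> \<exists>u\<in>V. \<exists>v\<in>V. u \<noteq> v \<and> e = {u, v}"
  shows "\<exists>f. inj_on f E \<and> (\<forall>e\<in>E. f e \<in> e \<and> f e \<noteq> r)"
proof -
  have "finite E"
  proof (rule finite_subset)
    show "E \<subseteq> Pow V" using E by blast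
  qed (simp add: V)
  then show ?thesis
    using ac E
  proof (induction "card E" arbitrary: E)
    case 0
    then show ?case by simp
  next
    case (Suc k)
    then have "E \<noteq> {}" by auto
    obtain v e where v: "v \<noteq> r" "e \<in> E" "v \<in> e" "\<And>e'. e' \<in> E \<Longrightarrow> v \<in> e' \<Longrightarrow> e' = e"
      using acyclic_edges_leaf[OF Suc.prems(2) V Suc.prems(3) \<open>E \<noteq> {}\<close>, of r] by blast
    \<comment> \<open>Once the leaf edge \<open>e\<close> is removed, \<open>v\<close> lies on no
      remaining edge, so it is still free to serve as the lower endpoint of
      \<open>e\<close>.\<close>
    have "\<exists>f. inj_on f (E - {e}) \<and> (\<forall>e'\<in>E - {e}. f e' \<in> e' \<and> f e' \<noteq> r)"
    proof (rule Suc.hyps(1))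
      show "k = card (E - {e})" using Suc.hyps(2) v(2) by simp
      show "acyclic_edges V (E - {e})" by (rule acyclic_edges_mono[OF Suc.prems(2)]) auto
      show "finite (E - {e})" using Suc.prems(1) by simp
      show "\<exists>u\<in>V. \<exists>w\<in>V. u \<noteq> w \<and> e' = {u, w}" if "e' \<in> E - {e}" for e'
        using Suc.prems(3) that by blast
    qed
    then obtain f where f: "inj_on f (E - {e})" "\<And>e'. e' \<in> E - {e} \<Longrightarrow> f e' \<in> e' \<and> f e' \<noteq> r"
      by blast
    have "f e' \<noteq> v" if "e' \<in> E - {e}" for e'
      using f(2)[OF that] v(4)[of e'] that by blast
    then have "inj_on (f(e := v)) E"
      using f(1) by (auto simp: inj_on_def)
    moreover have "\<forall>e'\<in>E. (f(e := v)) e' \<in> e' \<and> (f(e := v)) e' \<noteq> r"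
      using f(2) v(1,3) by simp
    ultimately show ?case by blast
  qed
qed

text \<open>Orient the forest away from \<open>c\<close> and charge each edge to its lower endpoint:
  the other end weighs at most \<open>x c\<close>, and the charged vertices are distinct and differ
  from \<open>c\<close>. Under the strict inequalities, equality forces every vertex other than
  \<open>c\<close> to be charged and every upper endpoint to be \<open>c\<close>, which is a
  star.\<close>

lemma forest_weight:
  fixes x :: "'a \<Rightarrow> real"
  assumes ac: "acyclic_edges V E" and V: "finite V"
    and E: "\<And>e. e \<in> E \<Longrightarrow> \<exists>u\<in>V. \<exists>v\<in>V. u \<noteq> v \<and> e = {u, v}"
    and x: "\<And>v. v \<in> V \<Longrightarrow> 0 \<le> x v \<and> x v \<le> x c"
  shows forest_weight_le: "(\<Sum>e\<in>E. prod x e) \<le> x c * (\<Sum>v\<in>V - {c}. x v)"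
    and forest_weight_eq:
      "\<lbrakk>(\<Sum>e\<in>E. prod x e) = x c * (\<Sum>v\<in>V - {c}. x v); c \<in> V; \<And>v. v \<in> V - {c} \<Longrightarrow> 0 < x v \<and> x v < x c\<rbrakk>
        \<Longrightarrow> E = (\<lambda>v. {c, v}) ` (V - {c})"
proof -
  obtain f where f: "inj_on f E" "\<And>e. e \<in> E \<Longrightarrow> f e \<in> e \<and> f e \<noteq> c"
    using acyclic_edges_orientation[OF ac V E, of c] by blast
  have "E \<subseteq> Pow V" using E by blast
  then have finE: "finite E" using V by (simp add: finite_subset)
  have img: "f ` E \<subseteq> V - {c}"
  proof
    fix v assume "v \<in> f ` E"
    then obtain e where e: "e \<in> E" "v = f e" by blast
    then have "v \<in> e" "v \<noteq> c" using f(2) by auto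
    then show "v \<in> V - {c}" using E[OF e(1)] by blast
  qed
  have other: "\<exists>u\<in>V. u \<noteq> f e \<and> e = {f e, u}" if "e \<in> E" for e
  proof -
    obtain u v where uv: "u \<in> V" "v \<in> V" "u \<noteq> v" "e = {u, v}" using E[OF \<open>e \<in> E\<close>] by metis
    have "f e \<in> e" using f(2) \<open>e \<in> E\<close> by simp
    then have "f e = u \<or> f e = v" unfolding uv(4) by simp
    then show ?thesis using uv by (metis insert_commute)
  qed
  have edge: "prod x e \<le> x c * x (f e)" if e: "e \<in> E" for e
  proof -
    obtain u where u: "u \<in> V" "u \<noteq> f e" "e = {f e, u}" using other[OF e] by metis
    have "prod x {f e, u} = x (f e) * x u" using u(2) by simp
    then have "prod x e = x (f e) * x u" using u(3) by metis
    also have "\<dots> \<le> x (f e) * x c"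
    proof (rule mult_left_mono)
      have "f e \<in> V" using img e by blast
      then show "0 \<le> x (f e)" using x by simp
      show "x u \<le> x c" using x[OF u(1)] by simp
    qed
    finally show ?thesis by (simp add: mult.commute)
  qed
  have s1: "(\<Sum>e\<in>E. prod x e) \<le> (\<Sum>e\<in>E. x c * x (f e))" using edge by (intro sum_mono)
  have s2: "(\<Sum>e\<in>E. x c * x (f e)) = x c * (\<Sum>v\<in>f ` E. x v)"
    by (simp add: sum.reindex[OF f(1)] sum_distrib_left)
  have s3: "x c * (\<Sum>v\<in>f ` E. x v) \<le> x c * (\<Sum>v\<in>V - {c}. x v)"
  \<comment> \<open>For empty \<open>V\<close> nothing is known about the sign of
    \<open>x c\<close>, but both sums are empty.\<close>
  proof (cases "V = {}")
    case True
    then have "f ` E = {}" using img by blast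
    then show ?thesis using True by simp
  next
    case False
    then obtain v where "v \<in> V" by blast
    then have "0 \<le> x c" using x[of v] by linarith
    moreover have "(\<Sum>v\<in>f ` E. x v) \<le> (\<Sum>v\<in>V - {c}. x v)"
      using x V img by (intro sum_mono2) auto
    ultimately show ?thesis by (rule mult_left_mono[rotated])
  qed
  show "(\<Sum>e\<in>E. prod x e) \<le> x c * (\<Sum>v\<in>V - {c}. x v)" using s1 s2 s3 by simp
  assume eq: "(\<Sum>e\<in>E. prod x e) = x c * (\<Sum>v\<in>V - {c}. x v)" and c: "c \<in> V"
    and strict: "\<And>v. v \<in> V - {c} \<Longrightarrow> 0 < x v \<and> x v < x c"
  have img_eq: "f ` E = V - {c}"
  proof (rule ccontr)
    assume "f ` E \<noteq> V - {c}"
    then obtain w where w: "w \<in> V - {c}" "w \<notin> f ` E" using img by (metis subsetI subset_antisym)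
    have "(\<Sum>v\<in>f ` E. x v) < (\<Sum>v\<in>V - {c}. x v)"
    proof (rule sum_strict_mono2[OF _ img, of w])
      show "finite (V - {c})" using V by simp
      show "w \<in> V - {c} - f ` E" using w by blast
      show "0 < x w" using strict[OF w(1)] by simp
      show "0 \<le> x v" if "v \<in> V - {c}" for v using strict[OF that] by simp
    qed
    moreover have "0 < x c" using strict[OF w(1)] by simp
    ultimately have "x c * (\<Sum>v\<in>f ` E. x v) < x c * (\<Sum>v\<in>V - {c}. x v)"
      by (rule mult_strict_left_mono)
    then show False using s1 s2 eq by linarith
  qed
  have root: "e = {c, f e}" if e: "e \<in> E" for e
  proof (rule ccontr)
    assume ne: "e \<noteq> {c, f e}"
    obtain u where u: "u \<in> V" "u \<noteq> f e" "e = {f e, u}" using other[OF e] by metis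
    have "u \<noteq> c" using ne u(3) by (metis insert_commute)
    then have "u \<in> V - {c}" using u(1) by simp
    moreover have fe: "f e \<in> V - {c}" using img e by auto
    ultimately have lt: "x (f e) * x u < x (f e) * x c"
      using strict[of u] strict[of "f e"] by (intro mult_strict_left_mono) blast+
    have "prod x {f e, u} = x (f e) * x u" using u(2) by simp
    then have "prod x e = x (f e) * x u" using u(3) by metis
    with lt have strict_e: "prod x e < x c * x (f e)" by (simp add: mult.commute)
    have "(\<Sum>e\<in>E. prod x e) < (\<Sum>e\<in>E. x c * x (f e))"
    proof (rule sum_strict_mono_ex1[OF finE])
      show "\<forall>e\<in>E. prod x e \<le> x c * x (f e)" using edge by blast
      show "\<exists>e\<in>E. prod x e < x c * x (f e)" using e strict_e by blast
    qed
    then show False using s2 s3 eq by linarith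
  qed
  have "(\<lambda>e. e) ` E = (\<lambda>e. {c, f e}) ` E" by (intro image_cong refl root)
  then have "E = (\<lambda>e. {c, f e}) ` E" by simp
  also have "\<dots> = (\<lambda>v. {c, v}) ` f ` E" by (simp add: image_image)
  also have "\<dots> = (\<lambda>v. {c, v}) ` (V - {c})" by (simp only: img_eq)
  finally show "E = (\<lambda>v. {c, v}) ` (V - {c})" .
qed

section \<open>Double stars\<close>

text \<open>\<open>c\<close> and \<open>d\<close> are the centres of the stars on \<open>P\<close>
  and \<open>Q\<close>; \<open>u\<close> and \<open>w\<close> are the leaves that get joined. That
  they differ from the centres is imposed in \<open>double_star_data\<close>.\<close>

definition double_star :: "'a set \<Rightarrow> 'a \<Rightarrow> 'a \<Rightarrow> 'a set \<Rightarrow> 'a \<Rightarrow> 'a \<Rightarrow> 'a graph" where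
  "double_star P c u Q d w =
    (P \<union> Q, (\<lambda>v. {c, v}) ` (P - {c}) \<union> (\<lambda>v. {d, v}) ` (Q - {d}) \<union> {{u, w}})"

lemma double_star_swap: "double_star Q d w P c u = double_star P c u Q d w"
  by (auto simp: double_star_def insert_commute)

locale double_star_data =
  fixes P :: "'a set" and c u :: 'a and Q :: "'a set" and d w :: 'a
  assumes fin: "finite P" "finite Q" and disj: "P \<inter> Q = {}"
    and P: "c \<in> P" "u \<in> P" "c \<noteq> u" and Q: "d \<in> Q" "w \<in> Q" "d \<noteq> w"
begin

abbreviation "E \<equiv> snd (double_star P c u Q d w)"

lemma swap: "double_star_data Q d w P c u"
  using fin disj P Q by unfold_locales auto

lemma vertices: "fst (double_star P c u Q d w) = P \<union> Q"
  by (simp add: double_star_def)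

lemma edge_iff:
  "{x, y} \<in> E \<longleftrightarrow> (x = c \<and> y \<in> P - {c}) \<or> (y = c \<and> x \<in> P - {c})
    \<or> (x = d \<and> y \<in> Q - {d}) \<or> (y = d \<and> x \<in> Q - {d}) \<or> (x = u \<and> y = w) \<or> (x = w \<and> y = u)"
  by (auto simp: double_star_def doubleton_eq_iff image_iff)

lemma neighbours:
  "{y. {c, y} \<in> E} = P - {c}" "{y. {d, y} \<in> E} = Q - {d}"
  "{y. {u, y} \<in> E} = {c, w}" "{y. {w, y} \<in> E} = {d, u}"
  "v \<in> P - {c, u} \<Longrightarrow> {y. {v, y} \<in> E} = {c}" "v \<in> Q - {d, w} \<Longrightarrow> {y. {v, y} \<in> E} = {d}"
  using P Q disj unfolding edge_iff by auto

lemma simple: "simple_graph (double_star P c u Q d w)"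
  unfolding simple_graph_def
proof (intro conjI ballI)
  show "finite (fst (double_star P c u Q d w))" using fin by (simp add: double_star_def)
  fix e assume "e \<in> E"
  then obtain x y where "e = {x, y}" "{x, y} \<in> E" by (auto simp: double_star_def)
  then show "\<exists>x\<in>fst (double_star P c u Q d w). \<exists>y\<in>fst (double_star P c u Q d w). x \<noteq> y \<and> e = {x, y}"
    using P Q disj unfolding edge_iff by (intro bexI[of _ x] bexI[of _ y]) (auto simp: double_star_def)
qed

lemma connected: "graph_connected (double_star P c u Q d w)"
proof -
  let ?R = "{(x, y). {x, y} \<in> E}"
  have sym: "sym (?R\<^sup>*)" by (intro sym_rtrancl symI) (simp add: insert_commute)
  have cd: "(d, c) \<in> ?R\<^sup>*"
  proof -
    have "(d, w) \<in> ?R" "(w, u) \<in> ?R" "(u, c) \<in> ?R" using P Q by (auto simp: edge_iff)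
    then show ?thesis by (meson converse_rtrancl_into_rtrancl rtrancl.rtrancl_refl)
  qed
  have "(x, c) \<in> ?R\<^sup>*" if "x \<in> P \<union> Q" for x
  proof (cases "x \<in> P")
    case True
    then have "x = c \<or> (x, c) \<in> ?R" by (auto simp: edge_iff)
    then show ?thesis by auto
  next
    case False
    then have "x = d \<or> (x, d) \<in> ?R" using that by (auto simp: edge_iff)
    then have "(x, d) \<in> ?R\<^sup>*" by auto
    then show ?thesis using cd by (rule rtrancl_trans)
  qed
  then have "(x, y) \<in> ?R\<^sup>*" if "x \<in> P \<union> Q" "y \<in> P \<union> Q" for x y
    using that sym by (meson rtrancl_trans symE)
  then show ?thesis using P by (auto simp: graph_connected_def double_star_def)
qed

text \<open>A free leaf has one neighbour, so a cycle avoids it. Then the centres have at most one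
  neighbour left on the cycle and are avoided too, and only \<open>u\<close> and \<open>w\<close>
  remain.\<close>

lemma no_cycle: "\<not> is_cycle (double_star P c u Q d w) p"
proof
  assume cyc: "is_cycle (double_star P c u Q d w) p"
  have two: "\<exists>x y. x \<in> set p \<and> y \<in> set p \<and> x \<noteq> y \<and> x \<in> {y. {v, y} \<in> E} \<and> y \<in> {y. {v, y} \<in> E}"
    if "v \<in> set p" for v
    using cycle_two_neighbours[OF cyc that] by (metis mem_Collect_eq)
  have p: "set p \<subseteq> P \<union> Q" "distinct p" "length p \<ge> 3"
    using cyc by (auto simp: is_cycle_def double_star_def)
  have "v \<notin> set p" if "v \<in> P - {c, u}" for v
    using two[of v] neighbours(5)[OF that] by auto
  moreover have "v \<notin> set p" if "v \<in> Q - {d, w}" for v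
    using two[of v] neighbours(6)[OF that] by auto
  ultimately have s: "set p \<subseteq> {c, u, d, w}" using p(1) by blast
  have "c \<notin> set p" using two[of c] s P Q disj unfolding neighbours by auto
  moreover have "d \<notin> set p" using two[of d] s P Q disj unfolding neighbours by auto
  ultimately have "set p \<subseteq> {u, w}" using s by blast
  then have "card (set p) \<le> card {u, w}" by (intro card_mono) auto
  also have "\<dots> \<le> 2" by (simp add: card_insert_if)
  finally have "card (set p) \<le> 2" .
  then show False using p(2,3) by (simp add: distinct_card)
qed

lemma is_tree: "is_tree (double_star P c u Q d w)"
  using simple connected no_cycle by (simp add: is_tree_def)

lemma weight:
  fixes x :: "'a \<Rightarrow> real"
  shows "(\<Sum>e\<in>E. prod x e) = x c * (\<Sum>v\<in>P - {c}. x v) + x d * (\<Sum>v\<in>Q - {d}. x v) + x u * x w"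
proof -
  have star: "(\<Sum>e\<in>(\<lambda>v. {r, v}) ` (A - {r}). prod x e) = x r * (\<Sum>v\<in>A - {r}. x v)" for r and A :: "'a set"
  proof -
    have "inj_on (\<lambda>v. {r, v}) (A - {r})" by (auto simp: inj_on_def doubleton_eq_iff)
    then have "(\<Sum>e\<in>(\<lambda>v. {r, v}) ` (A - {r}). prod x e) = (\<Sum>v\<in>A - {r}. prod x {r, v})"
      by (simp add: sum.reindex)
    also have "\<dots> = (\<Sum>v\<in>A - {r}. x r * x v)" by (intro sum.cong) auto
    finally show ?thesis by (simp add: sum_distrib_left)
  qed
  have "u \<noteq> w" using P Q disj by auto
  have "(\<lambda>v. {c, v}) ` (P - {c}) \<inter> (\<lambda>v. {d, v}) ` (Q - {d}) = {}"
    using P Q disj by (auto simp: doubleton_eq_iff)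
  moreover have "{u, w} \<notin> (\<lambda>v. {c, v}) ` (P - {c}) \<union> (\<lambda>v. {d, v}) ` (Q - {d})"
    using P Q disj by (auto simp: doubleton_eq_iff)
  ultimately show ?thesis
    using fin \<open>u \<noteq> w\<close> by (simp add: double_star_def sum.union_disjoint star)
qed

lemma iso_joined_stars:
  "graph_iso (double_star P c u Q d w) (joined_stars (card P - 1) (card Q - 1))"
proof -
  \<comment> \<open>Numbers a star to match \<open>star\<close>: the centre becomes 0, the joined
    leaf 1, and the free leaves take the numbers from 2 on in any order.\<close>
  have bij: "\<exists>f. bij_betw f A {0..card A - 1} \<and> f r = 0 \<and> f s = (1::nat)"
    if A: "finite A" "r \<in> A" "s \<in> A" "r \<noteq> s" for A :: "'a set" and r s
  proof -
    have c2: "card A \<ge> 2" using card_mono[of A "{r, s}"] A by simp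
    have "card (A - {r, s}) = card {2..card A - 1}"
      using A c2 by (simp add: card_Diff_subset)
    then obtain g where g: "bij_betw g (A - {r, s}) {2..card A - 1}"
      using A(1) finite_same_card_bij by blast
    let ?f = "\<lambda>v. if v = r then 0 else if v = s then 1 else g v"
    have "bij_betw ?f (A - {r, s}) {2..card A - 1}"
      using g by (rule bij_betw_cong[THEN iffD1, rotated]) auto
    moreover have "bij_betw ?f {r, s} {0, 1}" using A(4) by (auto simp: bij_betw_def)
    ultimately have "bij_betw ?f (A - {r, s} \<union> {r, s}) ({2..card A - 1} \<union> {0, 1})"
      by (rule bij_betw_combine) auto
    moreover have "A - {r, s} \<union> {r, s} = A" using A by auto
    moreover have "{2..card A - 1} \<union> {0, 1} = {0..card A - 1}" using c2 by auto
    ultimately show ?thesis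
      using A(4) by (intro exI[of _ ?f]) simp
  qed
  obtain f where f: "bij_betw f P {0..card P - 1}" "f c = 0" "f u = 1"
    using bij[OF fin(1) P] by blast
  obtain g where g: "bij_betw g Q {0..card Q - 1}" "g d = 0" "g w = 1"
    using bij[OF fin(2) Q] by blast
  define h where "h v = (if v \<in> P then Inl (f v) else Inr (g v))" for v
  have hP: "h v = Inl (f v)" if "v \<in> P" for v using that by (simp add: h_def)
  have hQ: "h v = Inr (g v)" if "v \<in> Q" for v using that disj by (auto simp: h_def)
  have fst_js: "fst (joined_stars (card P - 1) (card Q - 1)) = Inl ` {0..card P - 1} \<union> Inr ` {0..card Q - 1}"
    by (auto simp: joined_stars_def disjoint_union_def star_def Let_def)
  have "bij_betw h P (Inl ` {0..card P - 1})"
  proof -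
    have "bij_betw (Inl \<circ> f) P (Inl ` {0..card P - 1})"
      using f(1) by (intro bij_betw_trans[OF f(1)]) (simp add: bij_betw_def)
    then show ?thesis by (rule bij_betw_cong[THEN iffD1, rotated]) (simp add: hP)
  qed
  moreover have "bij_betw h Q (Inr ` {0..card Q - 1})"
  proof -
    have "bij_betw (Inr \<circ> g) Q (Inr ` {0..card Q - 1})"
      using g(1) by (intro bij_betw_trans[OF g(1)]) (simp add: bij_betw_def)
    then show ?thesis by (rule bij_betw_cong[THEN iffD1, rotated]) (simp add: hQ)
  qed
  ultimately have h: "bij_betw h (P \<union> Q) (Inl ` {0..card P - 1} \<union> Inr ` {0..card Q - 1})"
    by (rule bij_betw_combine) auto
  define p q where "p = card P - 1" and "q = card Q - 1"
  have js_ll: "{Inl i, Inl j} \<in> snd (joined_stars p q)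
      \<longleftrightarrow> (i = 0 \<and> 1 \<le> j \<and> j \<le> p) \<or> (j = 0 \<and> 1 \<le> i \<and> i \<le> p)" for i j
  proof -
    have "{Inl i, Inl j} \<in> snd (joined_stars p q) \<longleftrightarrow> (\<exists>k. 1 \<le> k \<and> k \<le> p \<and> {Inl i, Inl j} = {Inl 0, Inl k :: nat + nat})"
      by (auto simp: joined_stars_def disjoint_union_def star_def Let_def image_iff doubleton_eq_iff)
    then show ?thesis by (auto simp: doubleton_eq_iff)
  qed
  have js_rr: "{Inr i, Inr j} \<in> snd (joined_stars p q)
      \<longleftrightarrow> (i = 0 \<and> 1 \<le> j \<and> j \<le> q) \<or> (j = 0 \<and> 1 \<le> i \<and> i \<le> q)" for i j
  proof -
    have "{Inr i, Inr j} \<in> snd (joined_stars p q) \<longleftrightarrow> (\<exists>k. 1 \<le> k \<and> k \<le> q \<and> {Inr i, Inr j} = {Inr 0, Inr k :: nat + nat})"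
      by (auto simp: joined_stars_def disjoint_union_def star_def Let_def image_iff doubleton_eq_iff)
    then show ?thesis by (auto simp: doubleton_eq_iff)
  qed
  have js_lr: "{Inl i, Inr j} \<in> snd (joined_stars p q) \<longleftrightarrow> i = 1 \<and> j = 1" for i j
    by (auto simp: joined_stars_def disjoint_union_def star_def Let_def doubleton_eq_iff)
  have f_iff: "f x = 0 \<longleftrightarrow> x = c" "f x = 1 \<longleftrightarrow> x = u" "f x \<le> p" if "x \<in> P" for x
  proof -
    show "f x = 0 \<longleftrightarrow> x = c" "f x = 1 \<longleftrightarrow> x = u"
      using inj_on_eq_iff[OF bij_betw_imp_inj_on[OF f(1)] that] P f(2,3) by metis+
    show "f x \<le> p" using bij_betwE[OF f(1)] that by (auto simp: p_def)
  qed
  have g_iff: "g x = 0 \<longleftrightarrow> x = d" "g x = 1 \<longleftrightarrow> x = w" "g x \<le> q" if "x \<in> Q" for x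
  proof -
    show "g x = 0 \<longleftrightarrow> x = d" "g x = 1 \<longleftrightarrow> x = w"
      using inj_on_eq_iff[OF bij_betw_imp_inj_on[OF g(1)] that] Q g(2,3) by metis+
    show "g x \<le> q" using bij_betwE[OF g(1)] that by (auto simp: q_def)
  qed
  have f_pos: "1 \<le> f x \<longleftrightarrow> x \<noteq> c" if "x \<in> P" for x using f_iff(1)[OF that] by linarith
  have g_pos: "1 \<le> g x \<longleftrightarrow> x \<noteq> d" if "x \<in> Q" for x using g_iff(1)[OF that] by linarith
  have "{x, y} \<in> E \<longleftrightarrow> {h x, h y} \<in> snd (joined_stars p q)" if xy: "x \<in> P \<union> Q" "y \<in> P \<union> Q" for x y
  proof -
    consider "x \<in> P" "y \<in> P" | "x \<in> P" "y \<in> Q" | "x \<in> Q" "y \<in> P" | "x \<in> Q" "y \<in> Q"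
      using xy by blast
    then show ?thesis
    proof cases
      case 1
      then have "x \<notin> Q" "y \<notin> Q" using disj by auto
      with 1 show ?thesis
        unfolding hP[OF 1(1)] hP[OF 1(2)] js_ll f_pos[OF 1(1)] f_pos[OF 1(2)] edge_iff
        using f_iff[OF 1(1)] f_iff[OF 1(2)] Q by auto
    next
      case 2
      then have "x \<notin> Q" "y \<notin> P" using disj by auto
      with 2 show ?thesis
        unfolding hP[OF 2(1)] hQ[OF 2(2)] js_lr f_iff(2)[OF 2(1)] g_iff(2)[OF 2(2)] edge_iff
        using P Q by auto
    next
      case 3
      then have "x \<notin> P" "y \<notin> Q" using disj by auto
      with 3 show ?thesis
        unfolding hP[OF 3(2)] hQ[OF 3(1)] insert_commute[of "Inr (g x)"] js_lr f_iff(2)[OF 3(2)] g_iff(2)[OF 3(1)] edge_iff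
        using P Q by auto
    next
      case 4
      then have "x \<notin> P" "y \<notin> P" using disj by auto
      with 4 show ?thesis
        unfolding hQ[OF 4(1)] hQ[OF 4(2)] js_rr g_pos[OF 4(1)] g_pos[OF 4(2)] edge_iff
        using g_iff[OF 4(1)] g_iff[OF 4(2)] P by auto
    qed
  qed
  then have "\<forall>x\<in>P \<union> Q. \<forall>y\<in>P \<union> Q. {x, y} \<in> E \<longleftrightarrow> {h x, h y} \<in> snd (joined_stars (card P - 1) (card Q - 1))"
    unfolding p_def q_def by blast
  then show ?thesis
    unfolding graph_iso_def vertices fst_js using h by blast
qed

end

section \<open>Double stars as admissible competitors\<close>

lemma double_star_unbalanced_spanning:
  assumes "double_star_data P c u Q d w" and PQ: "P \<union> Q = {0..<n}"
  shows "spanning_tree (complete_graph n) (double_star P c u Q d w)"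
    and "\<not> balanced (signed_complete n (double_star P c u Q d w))"
proof -
  interpret double_star_data P c u Q d w by fact
  have sub: "E \<subseteq> snd (complete_graph n)"
  proof
    fix e assume "e \<in> E"
    then have "\<exists>x\<in>P \<union> Q. \<exists>y\<in>P \<union> Q. x \<noteq> y \<and> e = {x, y}"
      using simple vertices unfolding simple_graph_def by simp
    then obtain x y where "x \<in> P \<union> Q" "y \<in> P \<union> Q" "x \<noteq> y" "e = {x, y}" by metis
    then show "e \<in> snd (complete_graph n)" unfolding PQ by (auto simp: complete_graph_def)
  qed
  then show "spanning_tree (complete_graph n) (double_star P c u Q d w)"
    using is_tree PQ by (simp add: spanning_tree_def complete_graph_def double_star_def)
  have lt: "c < n" "d < n" "u < n" using P Q PQ by auto
  have ne: "c \<noteq> d" "u \<noteq> d" using P Q disj by auto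
  have image: "cycle_edges xs = (\<lambda>i. {xs ! i, xs ! (Suc i mod length xs)}) ` {..<length xs}" for xs :: "nat list"
    unfolding cycle_edges_def by blast
  \<comment> \<open>The triangle on \<open>c\<close>, \<open>u\<close>, \<open>d\<close> is a
    negative cycle, because \<open>{c, u}\<close> is its only edge in the double star.\<close>
  have ce: "cycle_edges [c, u, d] = {{c, u}, {u, d}, {d, c}}"
    unfolding image by (simp add: lessThan_Suc insert_commute)
  have cyc: "is_cycle (fst (signed_complete n (double_star P c u Q d w))) [c, u, d]"
    using lt ne P by (auto simp: is_cycle_def ce signed_complete_def complete_graph_def)
  have "{e \<in> cycle_edges [c, u, d]. snd (signed_complete n (double_star P c u Q d w)) e = -1} = {{c, u}}"
    using P Q ne disj unfolding ce signed_complete_def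
    by (auto simp: edge_iff split: if_splits)
  then have "\<not> positive_cycle (signed_complete n (double_star P c u Q d w)) [c, u, d]"
    by (simp add: positive_cycle_def)
  then show "\<not> balanced (signed_complete n (double_star P c u Q d w))"
    using cyc by (auto simp: balanced_def)
qed

section \<open>Greatest weight of a tree for weights of both signs\<close>

lemma tree_edge_between:
  assumes "is_tree T" "fst T = P \<union> Q" "P \<noteq> {}" "Q \<noteq> {}" "P \<inter> Q = {}"
  obtains a b where "a \<in> P" "b \<in> Q" "{a, b} \<in> snd T"
proof -
  obtain r t where rt: "r \<in> P" "t \<in> Q" using assms by auto
  have path: "(r, t) \<in> {(x, y). {x, y} \<in> snd T}\<^sup>*"
    using assms rt by (auto simp: is_tree_def graph_connected_def)
  \<comment> \<open>A walk that starts in \<open>P\<close> and ends outside must use an edge leaving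
    \<open>P\<close>.\<close>
  have "\<exists>a b. a \<in> P \<and> b \<notin> P \<and> {a, b} \<in> snd T" if "y \<notin> P" "(r, y) \<in> {(x, y). {x, y} \<in> snd T}\<^sup>*" for y
    using that(2,1) by (induction rule: rtrancl_induct) (use rt in auto)
  then obtain a b where ab: "a \<in> P" "b \<notin> P" "{a, b} \<in> snd T"
    using path rt assms(5) by (metis disjoint_iff)
  have "simple_graph T" using assms(1) by (simp add: is_tree_def)
  then have "\<exists>u\<in>fst T. \<exists>v\<in>fst T. u \<noteq> v \<and> {a, b} = {u, v}"
    using ab(3) unfolding simple_graph_def by blast
  then have "b \<in> fst T" by (metis doubleton_eq_iff)
  then show ?thesis using that ab assms(2) by blast
qed

text \<open>Split the edges into those inside \<open>P\<close>, those inside \<open>Q\<close> and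
  those crossing. The first two kinds form forests, bounded by stars. Crossing edges have
  nonpositive products, at least one of them exists, and none exceeds the product at
  \<open>u\<close> and \<open>w\<close>. In case of equality all three bounds are attained.\<close>

lemma tree_weight_two_signs:
  fixes x :: "'a \<Rightarrow> real"
  assumes T: "is_tree T" and V: "fst T = P \<union> Q" and disj: "P \<inter> Q = {}"
    and xP: "\<And>v. v \<in> P \<Longrightarrow> 0 \<le> x v \<and> x u \<le> x v \<and> x v \<le> x c"
    and xQ: "\<And>v. v \<in> Q \<Longrightarrow> x v \<le> 0 \<and> x v \<le> x w \<and> x d \<le> x v"
    and cu: "c \<in> P" "u \<in> P" and dw: "d \<in> Q" "w \<in> Q"
  defines "W \<equiv> x c * (\<Sum>v\<in>P - {c}. x v) + x d * (\<Sum>v\<in>Q - {d}. x v) + x u * x w"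
  shows tree_weight_two_signs_le: "(\<Sum>e\<in>snd T. prod x e) \<le> W"
    and tree_weight_two_signs_eq:
      "\<lbrakk>(\<Sum>e\<in>snd T. prod x e) = W;
        \<And>v. v \<in> P - {c} \<Longrightarrow> x v < x c; \<And>v. v \<in> P - {u} \<Longrightarrow> x u < x v; 0 < x u;
        \<And>v. v \<in> Q - {d} \<Longrightarrow> x d < x v; \<And>v. v \<in> Q - {w} \<Longrightarrow> x v < x w; x w < 0\<rbrakk>
        \<Longrightarrow> T = double_star P c u Q d w"
proof -
  let ?E = "snd T"
  have sg: "simple_graph T" using T by (simp add: is_tree_def)
  then have fV: "finite (P \<union> Q)" using V by (simp add: simple_graph_def)
  have E: "\<exists>a\<in>P \<union> Q. \<exists>b\<in>P \<union> Q. a \<noteq> b \<and> e = {a, b}" if "e \<in> ?E" for e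
    using sg that V by (simp add: simple_graph_def)
  have ac: "acyclic_edges (P \<union> Q) ?E"
    using T V unfolding is_tree_def acyclic_edges_def by (metis prod.collapse)
  have "?E \<subseteq> Pow (P \<union> Q)" using E by blast
  then have finE: "finite ?E" using fV by (simp add: finite_subset)
  define EP EQ EM where "EP = {e \<in> ?E. e \<subseteq> P}" and "EQ = {e \<in> ?E. e \<subseteq> Q}"
    and "EM = {e \<in> ?E. \<not> e \<subseteq> P \<and> \<not> e \<subseteq> Q}"
  have "?E = EP \<union> EQ \<union> EM" by (auto simp: EP_def EQ_def EM_def)
  moreover have "EP \<inter> EQ = {}"
  proof -
    have "e \<notin> EQ" if "e \<in> EP" for e
    proof
      assume "e \<in> EQ"
      then have "e \<subseteq> P \<inter> Q" "e \<in> ?E" using that by (auto simp: EP_def EQ_def)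
      then show False using disj E[of e] by auto
    qed
    then show ?thesis by blast
  qed
  moreover have "(EP \<union> EQ) \<inter> EM = {}" by (auto simp: EP_def EQ_def EM_def)
  ultimately have split: "(\<Sum>e\<in>?E. prod x e) = (\<Sum>e\<in>EP. prod x e) + (\<Sum>e\<in>EQ. prod x e) + (\<Sum>e\<in>EM. prod x e)"
    and EU: "?E = EP \<union> EQ \<union> EM"
    using finE by (simp_all add: sum.union_disjoint)
  have EP: "\<exists>a\<in>P. \<exists>b\<in>P. a \<noteq> b \<and> e = {a, b}" if "e \<in> EP" for e
    using E[of e] that unfolding EP_def by blast
  have EQ: "\<exists>a\<in>Q. \<exists>b\<in>Q. a \<noteq> b \<and> e = {a, b}" if "e \<in> EQ" for e
    using E[of e] that unfolding EQ_def by blast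
  have EM: "\<exists>a\<in>P. \<exists>b\<in>Q. e = {a, b}" if "e \<in> EM" for e
    using E[of e] that unfolding EM_def by (auto simp: insert_commute)
  have acP: "acyclic_edges P EP" and acQ: "acyclic_edges Q EQ"
    using acyclic_edges_mono[OF ac] by (auto simp: EP_def EQ_def)
  have fPQ: "finite P" "finite Q" using fV by auto
  \<comment> \<open>On \<open>Q\<close> the forest bound is applied to the negated weights, which
    leave the product over an edge unchanged.\<close>
  have neg: "(\<Sum>e\<in>EQ. prod (\<lambda>v. - x v) e) = (\<Sum>e\<in>EQ. prod x e)"
  proof (intro sum.cong refl)
    fix e assume "e \<in> EQ"
    then obtain a b where "a \<noteq> b" "e = {a, b}" using EQ by metis
    then show "prod (\<lambda>v. - x v) e = prod x e" by simp
  qed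
  have negsum: "- x d * (\<Sum>v\<in>Q - {d}. - x v) = x d * (\<Sum>v\<in>Q - {d}. x v)"
    by (simp add: sum_negf)
  have leP: "(\<Sum>e\<in>EP. prod x e) \<le> x c * (\<Sum>v\<in>P - {c}. x v)"
    by (rule forest_weight_le[OF acP fPQ(1) EP]) (use xP in auto)
  have leQ: "(\<Sum>e\<in>EQ. prod x e) \<le> x d * (\<Sum>v\<in>Q - {d}. x v)"
    unfolding neg[symmetric] negsum[symmetric]
    by (rule forest_weight_le[OF acQ fPQ(2) EQ]) (use xQ in auto)
  have cross: "x a * x b \<le> x u * x w" if "a \<in> P" "b \<in> Q" for a b
  proof -
    have "x u * (- x w) \<le> x a * (- x b)"
      using xP[OF that(1)] xQ[OF that(2)] xP[OF cu(2)] xQ[OF dw(2)] by (intro mult_mono) auto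
    then show ?thesis by simp
  qed
  have xuw: "x u * x w \<le> 0" using xP[OF cu(2)] xQ[OF dw(2)] by (simp add: mult_nonneg_nonpos)
  have prodX: "prod x e \<le> x u * x w" if e: "e \<in> EM" for e
  proof -
    obtain a b where ab: "a \<in> P" "b \<in> Q" "e = {a, b}" using EM[OF e] by blast
    then have "a \<noteq> b" using disj by blast
    then show ?thesis using cross[OF ab(1,2)] ab(3) by simp
  qed
  \<comment> \<open>Connectedness supplies one crossing edge; any further ones can only lower the
    sum.\<close>
  obtain a0 b0 where ab0: "a0 \<in> P" "b0 \<in> Q" "{a0, b0} \<in> ?E"
    using tree_edge_between[OF T V _ _ disj] cu dw by blast
  have e0: "{a0, b0} \<in> EM" using ab0 disj by (auto simp: EM_def)
  have finX: "finite EM" using finE by (simp add: EM_def)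
  have splitX: "(\<Sum>e\<in>EM. prod x e) = prod x {a0, b0} + (\<Sum>e\<in>EM - {{a0, b0}}. prod x e)"
    by (rule sum.remove[OF finX e0])
  have restX: "(\<Sum>e\<in>EM - {{a0, b0}}. prod x e) \<le> 0"
    by (rule sum_nonpos) (use prodX xuw in fastforce)
  have leX: "(\<Sum>e\<in>EM. prod x e) \<le> x u * x w"
    using splitX restX prodX[OF e0] by linarith
  show "(\<Sum>e\<in>?E. prod x e) \<le> W" unfolding split W_def using leP leQ leX by linarith
  assume eq: "(\<Sum>e\<in>?E. prod x e) = W"
    and sc: "\<And>v. v \<in> P - {c} \<Longrightarrow> x v < x c" and su: "\<And>v. v \<in> P - {u} \<Longrightarrow> x u < x v" and u0: "0 < x u"
    and sd: "\<And>v. v \<in> Q - {d} \<Longrightarrow> x d < x v" and sw: "\<And>v. v \<in> Q - {w} \<Longrightarrow> x v < x w" and w0: "x w < 0"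
  have eqP: "(\<Sum>e\<in>EP. prod x e) = x c * (\<Sum>v\<in>P - {c}. x v)"
    and eqQ: "(\<Sum>e\<in>EQ. prod x e) = x d * (\<Sum>v\<in>Q - {d}. x v)"
    and eqX: "(\<Sum>e\<in>EM. prod x e) = x u * x w"
    using eq leP leQ leX unfolding split W_def by linarith+
  have "EP = (\<lambda>v. {c, v}) ` (P - {c})"
  proof (rule forest_weight_eq[OF acP fPQ(1) EP _ eqP cu(1)])
    show "0 < x v \<and> x v < x c" if "v \<in> P - {c}" for v using sc[OF that] xP[of v] u0 that by auto
  qed (use xP in auto)
  moreover have "EQ = (\<lambda>v. {d, v}) ` (Q - {d})"
  proof (rule forest_weight_eq[OF acQ fPQ(2) EQ _ _ dw(1), where x = "\<lambda>v. - x v"])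
    show "0 < - x v \<and> - x v < - x d" if "v \<in> Q - {d}" for v using sd[OF that] xQ[of v] w0 that by auto
    show "(\<Sum>e\<in>EQ. prod (\<lambda>v. - x v) e) = - x d * (\<Sum>v\<in>Q - {d}. - x v)"
      unfolding neg negsum by (rule eqQ)
  qed (use xQ in auto)
  moreover have "EM = {{u, w}}"
  proof -
    have xuw0: "x u * x w < 0" using u0 w0 by (rule mult_pos_neg)
    \<comment> \<open>Crossing products are now strictly negative, so a second crossing edge would
      violate equality. The remaining edge must then attain the greatest crossing product, which
      only \<open>u\<close> and \<open>w\<close> do.\<close>
    have "EM - {{a0, b0}} = {}"
    proof (rule ccontr)
      assume ne: "EM - {{a0, b0}} \<noteq> {}"
      have "prod x e < 0" if "e \<in> EM - {{a0, b0}}" for e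
        using prodX[of e] that xuw0 by auto
      then have "(\<Sum>e\<in>EM - {{a0, b0}}. prod x e) < (\<Sum>e\<in>EM - {{a0, b0}}. 0)"
        using ne finX by (intro sum_strict_mono) auto
      then show False using splitX prodX[OF e0] eqX by simp
    qed
    then have EM1: "EM = {{a0, b0}}" using e0 by blast
    have "a0 \<noteq> b0" using ab0 disj by blast
    then have "x a0 * x b0 = x u * x w" using eqX EM1 by simp
    moreover have "x u * (- x w) < x a0 * (- x b0)" if "a0 \<noteq> u \<or> b0 \<noteq> w"
    proof (cases "a0 = u")
      case True
      then have "x b0 < x w" using that sw[of b0] ab0 by simp
      then show ?thesis unfolding True using u0 by simp
    next
      case False
      then have "x u < x a0" using su[of a0] ab0 by simp
      moreover have "x b0 \<le> x w" using xQ[OF ab0(2)] by simp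
      ultimately show ?thesis using u0 w0 by (intro mult_less_le_imp_less) auto
    qed
    ultimately have "a0 = u \<and> b0 = w" by force
    then show ?thesis using EM1 by simp
  qed
  ultimately have "snd T = snd (double_star P c u Q d w)" using EU by (simp add: double_star_def)
  then show "T = double_star P c u Q d w"
    using V by (simp add: prod_eq_iff double_star_def)
qed

section \<open>Eigenvectors of double stars\<close>

text \<open>The determinant of the two linear equations that remain, for the weights of the two joined
  vertices, after all other weights have been eliminated from the eigenvalue equations.\<close>

definition star_det :: "real \<Rightarrow> real \<Rightarrow> real \<Rightarrow> real" where
  "star_det p q m = (2 * p - (m\<^sup>2 - 4) / 4) * (2 * q - (m\<^sup>2 - 4) / 4)
    - (4 * p / m - (m\<^sup>2 + 4 * m - 4) / 4) * (4 * q / m - (m\<^sup>2 + 4 * m - 4) / 4)"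

text \<open>Expanded, the determinant depends on \<open>p\<close> and \<open>q\<close> only through
  their sum and their product, and the product has coefficient 4 - 16/m^2.\<close>

lemma star_det_diff:
  assumes "m \<noteq> 0" "p + q = p' + q'"
  shows "star_det p q m - star_det p' q' m = (4 - 16 / m\<^sup>2) * (p * q - p' * q')"
proof -
  define K L where "K = (m\<^sup>2 - 4) / 4" and "L = (m\<^sup>2 + 4 * m - 4) / 4"
  have e: "star_det p q m = (4 - 16 / m\<^sup>2) * (p * q) - (p + q) * (2 * K - 4 * L / m) + K\<^sup>2 - L\<^sup>2" for p q
    unfolding star_det_def K_def[symmetric] L_def[symmetric] using assms(1)
    by (simp add: field_simps power2_eq_square)
  show ?thesis unfolding e assms(2) right_diff_distrib by simp
qed

lemma star_det_less:
  assumes "m > 2" "p + q = p' + q'" "p' * q' < p * q"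
  shows "star_det p' q' m < star_det p q m"
proof -
  have "m\<^sup>2 > 2\<^sup>2" using assms(1) by (intro power_strict_mono) auto
  then have "4 - 16 / m\<^sup>2 > 0" by (simp add: divide_less_eq)
  then have "star_det p q m - star_det p' q' m > 0"
    using star_det_diff[of m p q p' q'] assms by simp
  then show ?thesis by simp
qed

text \<open>The eigenvalue equations of a double star with the weights on \<open>Q\<close> negated:
  \<open>a\<close>, \<open>g\<close>, \<open>B\<close> belong to the centre, the joined leaf and the
  sum over the free leaves of \<open>P\<close>, and \<open>e\<close>, \<open>d\<close>,
  \<open>C\<close> to those of \<open>Q\<close>; \<open>s\<close> is the coordinate sum. All is
  expressed through \<open>g\<close> and \<open>d\<close>.\<close>

lemma star_eigen_system:
  fixes m :: real
  assumes m: "m > 0"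
    and s: "s = a + g + B - e - d - C"
    and c: "m * a = 2 * (g + B) - s" and u: "m * g = 2 * (a - d) - s"
    and w: "m * d = 2 * (e - g) + s" and e: "m * e = 2 * (d + C) + s"
    and B: "m * B = p * (2 * a - s)" and C: "m * C = q * (2 * e + s)"
  shows "a = e" "a = (m + 2) * (g + d) / 4" "s = (m - 2) * (d - g) / 2"
    and "(2 * p - (m\<^sup>2 - 4) / 4) * g + (4 * p / m - (m\<^sup>2 + 4 * m - 4) / 4) * d = 0"
    and "(2 * q - (m\<^sup>2 - 4) / 4) * d + (4 * q / m - (m\<^sup>2 + 4 * m - 4) / 4) * g = 0"
proof -
  \<comment> \<open>Subtract the two centre equations; the formula for \<open>s\<close> turns the
    right-hand side into -2 (a - e).\<close>
  have "(m + 2) * (a - e) = 0" using s c e by (simp add: algebra_simps)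
  then show ae: "a = e" using m by simp
  show a: "a = (m + 2) * (g + d) / 4" using u w ae by (simp add: algebra_simps)
  show st: "s = (m - 2) * (d - g) / 2" using u w ae by (simp add: field_simps)
  \<comment> \<open>This is \<open>m\<close> times the weight of a free leaf of \<open>P\<close>,
    which is therefore g + 2d/m.\<close>
  have b: "2 * a - s = m * g + 2 * d" using u by (simp add: algebra_simps)
  have z: "2 * e + s = m * d + 2 * g" using w by (simp add: algebra_simps)
  have "B = p * (g + 2 * d / m)" using B m unfolding b by (simp add: field_simps)
  then have "m * a = 2 * g + 2 * p * (g + 2 * d / m) - s" using c by simp
  then show "(2 * p - (m\<^sup>2 - 4) / 4) * g + (4 * p / m - (m\<^sup>2 + 4 * m - 4) / 4) * d = 0"
    unfolding a st using m by (simp add: field_simps power2_eq_square)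
  have "C = q * (d + 2 * g / m)" using C m unfolding z by (simp add: field_simps)
  then have "m * a = 2 * d + 2 * q * (d + 2 * g / m) + s" using e ae by simp
  then show "(2 * q - (m\<^sup>2 - 4) / 4) * d + (4 * q / m - (m\<^sup>2 + 4 * m - 4) / 4) * g = 0"
    unfolding a st using m by (simp add: field_simps power2_eq_square)
qed

lemma two_by_two_det_zero:
  fixes A :: real
  assumes "A * g + B * d = 0" "D * d + C * g = 0" "d \<noteq> 0"
  shows "A * D - B * C = 0"
proof -
  have "d * (A * D - B * C) = A * (D * d + C * g) - C * (A * g + B * d)" by (simp add: algebra_simps)
  then show ?thesis using assms by simp
qed

text \<open>The two equations left over by \<open>star_eigen_system\<close>, solved with right-hand sides \<open>r, r\<close>
  by Cramer's rule. Equal residuals at the two centres do not change the coordinate sum.\<close>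

lemma star_test_vector:
  assumes m: "m > 2" and p: "p \<ge> 0" and q: "q \<ge> 0" and det: "star_det p q m > 0"
  obtains a b g d e z :: real where
    "4 * (a * (p * b + g) + e * (q * z + d) - g * d) - (a + p * b + g - e - q * z - d)\<^sup>2
      > m * (a\<^sup>2 + p * b\<^sup>2 + g\<^sup>2 + d\<^sup>2 + q * z\<^sup>2 + e\<^sup>2)"
proof -
  \<comment> \<open>Cramer's rule for the right-hand sides \<open>r\<close>, \<open>r\<close>: the
    two constants in the coefficients differ by \<open>m\<close>, and the factor \<open>m\<close> in
    \<open>r\<close> clears the denominators.\<close>
  define g d where "g = m * (2 * q + m) - 4 * p" and "d = m * (2 * p + m) - 4 * q"
  define r where "r = m * star_det p q m"
  \<comment> \<open>The other weights follow the formulas of the exact eigenvector, so all rows hold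
    except those of the two centres, which are off by \<open>r\<close>.\<close>
  define a s where "a = (m + 2) * (g + d) / 4" and "s = (m - 2) * (d - g) / 2"
  define b z where "b = g + 2 * d / m" and "z = d + 2 * g / m"
  have r: "r > 0" using m det by (simp add: r_def)
  have "g + d = 2 * (p + q) * (m - 2) + 2 * m\<^sup>2"
    by (simp add: g_def d_def power2_eq_square algebra_simps)
  also have "\<dots> > 0" using m p q by (intro add_nonneg_pos) auto
  finally have a: "a > 0" using m by (simp add: a_def)
  have K: "2 * p * b + 2 * g - s - m * a = (2 * p - (m\<^sup>2 - 4) / 4) * g + (4 * p / m - (m\<^sup>2 + 4 * m - 4) / 4) * d"
    unfolding b_def s_def a_def using m by (simp add: field_simps power2_eq_square)
  have L: "2 * q * z + 2 * d + s - m * a = (2 * q - (m\<^sup>2 - 4) / 4) * d + (4 * q / m - (m\<^sup>2 + 4 * m - 4) / 4) * g"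
    unfolding z_def s_def a_def using m by (simp add: field_simps power2_eq_square)
  have r1: "2 * p * b + 2 * g = s + m * a + r"
  proof -
    have "(2 * p - (m\<^sup>2 - 4) / 4) * g + (4 * p / m - (m\<^sup>2 + 4 * m - 4) / 4) * d = r"
      unfolding g_def d_def r_def star_det_def using m by (simp add: field_simps power2_eq_square)
    then show ?thesis using K by simp
  qed
  have r2: "2 * q * z + 2 * d = m * a + r - s"
  proof -
    have "(2 * q - (m\<^sup>2 - 4) / 4) * d + (4 * q / m - (m\<^sup>2 + 4 * m - 4) / 4) * g = r"
      unfolding g_def d_def r_def star_det_def using m by (simp add: field_simps power2_eq_square)
    then show ?thesis using L by simp
  qed
  have sum: "a + p * b + g - a - q * z - d = s" using r1 r2 by simp
  have bm: "2 * a - s = m * b" and gm: "2 * a - 2 * d - s = m * g"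
    and dm: "2 * a - 2 * g + s = m * d" and zm: "2 * a + s = m * z"
    unfolding a_def s_def b_def z_def using m by (simp_all add: field_simps)
  \<comment> \<open>Group the form by rows, each multiplied by its coordinate. The rows give
    \<open>m\<close> times the squared norm, and the residuals at the two centres add 2 a r >
    0.\<close>
  have "4 * (a * (p * b + g) + a * (q * z + d) - g * d) - s * (a + p * b + g - a - q * z - d)
      = a * (2 * p * b + 2 * g - s) + p * b * (2 * a - s) + g * (2 * a - 2 * d - s)
        + d * (2 * a - 2 * g + s) + q * z * (2 * a + s) + a * (2 * q * z + 2 * d + s)"
    by (simp add: algebra_simps)
  also have "\<dots> = m * (a\<^sup>2 + p * b\<^sup>2 + g\<^sup>2 + d\<^sup>2 + q * z\<^sup>2 + a\<^sup>2) + 2 * a * r"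
    unfolding bm gm dm zm r1 r2 by (simp add: power2_eq_square algebra_simps)
  finally have "4 * (a * (p * b + g) + a * (q * z + d) - g * d) - (a + p * b + g - a - q * z - d)\<^sup>2
      > m * (a\<^sup>2 + p * b\<^sup>2 + g\<^sup>2 + d\<^sup>2 + q * z\<^sup>2 + a\<^sup>2)"
    unfolding sum using a r by (simp add: power2_eq_square)
  then show ?thesis by (rule that)
qed

text \<open>If \<open>g\<close> were zero, both equations would determine \<open>p\<close> and
  \<open>q\<close> from \<open>m\<close>, and for m > 2 these values satisfy p > q + 1. This rules
  out a zero weight at the joined leaf \<open>u\<close>.\<close>

lemma star_eigen_first_nonzero:
  assumes m: "m > 2" and pq: "p \<le> q + 1" and d: "d > 0"
    and 1: "(2 * p - (m\<^sup>2 - 4) / 4) * g + (4 * p / m - (m\<^sup>2 + 4 * m - 4) / 4) * d = 0"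
    and 2: "(2 * q - (m\<^sup>2 - 4) / 4) * d + (4 * q / m - (m\<^sup>2 + 4 * m - 4) / 4) * g = 0"
  shows "g \<noteq> (0::real)"
proof
  assume "g = 0"
  then have "4 * p / m = (m\<^sup>2 + 4 * m - 4) / 4" and q: "2 * q = (m\<^sup>2 - 4) / 4"
    using 1 2 d by simp_all
  then have p: "4 * p = m * ((m\<^sup>2 + 4 * m - 4) / 4)" using m by (simp add: field_simps)
  have "m\<^sup>2 + 4 * m - 4 > 0" using m by (simp add: add_pos_pos) (smt (verit) zero_le_power2)
  then have "m * ((m\<^sup>2 + 4 * m - 4) / 4) > 2 * ((m\<^sup>2 + 4 * m - 4) / 4)"
    using m by (intro mult_strict_right_mono) auto
  then have "4 * p > (m\<^sup>2 + 4 * m - 4) / 2" unfolding p by simp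
  moreover have "4 * p \<le> (m\<^sup>2 - 4) / 2 + 4" using q pq by linarith
  ultimately show False using m by (simp add: field_simps)
qed

lemma spanning_tree_edges: "spanning_tree (complete_graph n) T \<Longrightarrow> snd T \<subseteq> snd (complete_graph n)"
  by (simp add: spanning_tree_def)

section \<open>Test vectors and eigenvectors of a spanning double star\<close>

locale spanning_double_star = double_star_data P c u Q d w
  for P :: "nat set" and c u Q d w +
  fixes n :: nat
  assumes PQ: "P \<union> Q = {0..<n}"
begin

abbreviation "DS \<equiv> double_star P c u Q d w"
abbreviation "mu \<equiv> gain_bound n DS"

lemma n_pos: "n > 0"
  using PQ P by (cases n) auto

lemma E_sub: "E \<subseteq> snd (complete_graph n)"
  using double_star_unbalanced_spanning(1)[OF double_star_data_axioms PQ] by (rule spanning_tree_edges)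

lemma sum_split:
  fixes f :: "nat \<Rightarrow> real"
  shows "(\<Sum>v\<in>P - {c}. f v) = (\<Sum>v\<in>P - {c, u}. f v) + f u"
    and "(\<Sum>v\<in>Q - {d}. f v) = (\<Sum>v\<in>Q - {d, w}. f v) + f w"
    and "(\<Sum>v<n. f v) = f c + f u + (\<Sum>v\<in>P - {c, u}. f v) + f d + f w + (\<Sum>v\<in>Q - {d, w}. f v)"
proof -
  have *: "(\<Sum>v\<in>A - {r}. f v) = (\<Sum>v\<in>A - {r, s}. f v) + f s" "(\<Sum>v\<in>A. f v) = f r + (\<Sum>v\<in>A - {r}. f v)"
    if "finite A" "r \<in> A" "s \<in> A" "r \<noteq> s" for A r s
  proof -
    have "A - {r} - {s} = A - {r, s}" by auto
    then show "(\<Sum>v\<in>A - {r}. f v) = (\<Sum>v\<in>A - {r, s}. f v) + f s"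
      using that sum.remove[of "A - {r}" s f] by simp
    show "(\<Sum>v\<in>A. f v) = f r + (\<Sum>v\<in>A - {r}. f v)" using that by (intro sum.remove)
  qed
  show 1: "(\<Sum>v\<in>P - {c}. f v) = (\<Sum>v\<in>P - {c, u}. f v) + f u" by (rule *) (use fin P in auto)
  show 2: "(\<Sum>v\<in>Q - {d}. f v) = (\<Sum>v\<in>Q - {d, w}. f v) + f w" by (rule *) (use fin Q in auto)
  have "(\<Sum>v<n. f v) = (\<Sum>v\<in>P \<union> Q. f v)" by (simp add: PQ atLeast0LessThan)
  also have "\<dots> = (\<Sum>v\<in>P. f v) + (\<Sum>v\<in>Q. f v)" using fin disj by (rule sum.union_disjoint)
  finally show "(\<Sum>v<n. f v) = f c + f u + (\<Sum>v\<in>P - {c, u}. f v) + f d + f w + (\<Sum>v\<in>Q - {d, w}. f v)"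
    using 1 2 *(2)[OF fin(1) P] *(2)[OF fin(2) Q] by simp
qed

text \<open>The number of free leaves of \<open>P\<close>; the truncated subtraction is exact
  because \<open>P\<close> contains the distinct vertices \<open>c\<close> and
  \<open>u\<close>.\<close>

definition p :: real where "p = real (card P - 2)"
definition q :: real where "q = real (card Q - 2)"

lemma card_leaves: "real (card (P - {c, u})) = p" "real (card (Q - {d, w})) = q"
  using P Q fin by (simp_all add: p_def q_def card_Diff_subset)

text \<open>The test vector takes the values \<open>a\<close>, \<open>g\<close>, \<open>b\<close> at
  the centre, the joined leaf and the free leaves of \<open>P\<close>, and \<open>- e\<close>,
  \<open>- h\<close>, \<open>- z\<close> at those of \<open>Q\<close>.\<close>

lemma block_gain_le:
  "4 * (a * (p * b + g) + e * (q * z + h) - g * h) - (a + p * b + g - e - q * z - h)\<^sup>2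
    \<le> mu * (a\<^sup>2 + p * b\<^sup>2 + g\<^sup>2 + h\<^sup>2 + q * z\<^sup>2 + e\<^sup>2)"
proof -
  define y where "y v = (if v = c then a else if v = u then g else if v = d then - e else
    if v = w then - h else if v \<in> P then b else - z)" for v
  have y: "y c = a" "y u = g" "y d = - e" "y w = - h"
    using P Q disj by (auto simp: y_def)
  have yP: "(\<Sum>v\<in>P - {c, u}. F (y v)) = p * F b" for F :: "real \<Rightarrow> real"
  proof -
    have "(\<Sum>v\<in>P - {c, u}. F (y v)) = (\<Sum>v\<in>P - {c, u}. F b)"
      using Q disj by (intro sum.cong refl arg_cong[of _ _ F]) (auto simp: y_def)
    then show ?thesis by (simp add: card_leaves)
  qed
  have yQ: "(\<Sum>v\<in>Q - {d, w}. F (y v)) = q * F (- z)" for F :: "real \<Rightarrow> real"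
  proof -
    have "(\<Sum>v\<in>Q - {d, w}. F (y v)) = (\<Sum>v\<in>Q - {d, w}. F (- z))"
      using P disj by (intro sum.cong refl arg_cong[of _ _ F]) (auto simp: y_def)
    then show ?thesis by (simp add: card_leaves)
  qed
  have "gain n E y = 4 * (a * (p * b + g) + e * (q * z + h) - g * h) - (a + p * b + g - e - q * z - h)\<^sup>2"
    unfolding gain_def weight sum_split y yP[of "\<lambda>t. t"] yQ[of "\<lambda>t. t"]
    by (simp add: power2_eq_square algebra_simps)
  moreover have "(\<Sum>i<n. (y i)\<^sup>2) = a\<^sup>2 + p * b\<^sup>2 + g\<^sup>2 + h\<^sup>2 + q * z\<^sup>2 + e\<^sup>2"
    unfolding sum_split(3)[of "\<lambda>i. (y i)\<^sup>2"] y yP[of "\<lambda>t. t\<^sup>2"] yQ[of "\<lambda>t. t\<^sup>2"] by simp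
  ultimately show ?thesis using gain_le[OF n_pos E_sub, of y] by simp
qed

text \<open>Test with 5 at the centres, 2 at the joined leaves and a total of 4 spread over the free
  leaves, with opposite signs on the two sides. The coordinate sum is 0, the gain is 224 and the
  squared norm is at most 90.\<close>

lemma mu_gt_2:
  assumes "p \<ge> 1" "q \<ge> 1"
  shows "mu > 2"
proof (rule ccontr)
  assume "\<not> mu > 2"
  define X Y where "X = p * (4 / p)\<^sup>2" and "Y = q * (4 / q)\<^sup>2"
  have XY: "X \<le> 16" "Y \<le> 16" "0 \<le> X" "0 \<le> Y"
    using assms by (simp_all add: X_def Y_def power2_eq_square field_simps)
  have "224 \<le> mu * (25 + X + 4 + 4 + Y + 25)"
    using block_gain_le[of 5 "4 / p" 2 5 "4 / q" 2] assms by (simp add: X_def Y_def)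
  also have "\<dots> \<le> 2 * (25 + X + 4 + 4 + Y + 25)"
    using \<open>\<not> mu > 2\<close> XY by (intro mult_right_mono) auto
  also have "\<dots> = 116 + 2 * X + 2 * Y" by simp
  finally show False using XY by simp
qed

text \<open>Test with \<open>sqrt r\<close> at the centres, 0 at the joined leaves and a total of
  \<open>r\<close> spread over the free leaves of each side: the gain is
  \<open>8 * r * sqrt r\<close> and the squared norm is at most 4r.\<close>

lemma mu_square_ge:
  assumes "p \<ge> r" "q \<ge> r" "r \<ge> 1"
  shows "4 * r \<le> mu\<^sup>2"
proof -
  have "p \<ge> 1" "q \<ge> 1" using assms by auto
  then have mu: "mu > 2" by (rule mu_gt_2)
  have sq: "p * (r / p)\<^sup>2 \<le> r" "q * (r / q)\<^sup>2 \<le> r"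
    using assms by (simp_all add: power2_eq_square field_simps mult_mono)
  have "8 * r * sqrt r \<le> mu * (r + p * (r / p)\<^sup>2 + q * (r / q)\<^sup>2 + r)"
    using block_gain_le[of "sqrt r" "r / p" 0 "sqrt r" "r / q" 0] assms \<open>p \<ge> 1\<close> \<open>q \<ge> 1\<close>
    by (simp add: algebra_simps)
  also have "\<dots> \<le> mu * (4 * r)" using sq mu by (intro mult_left_mono) auto
  finally have "2 * sqrt r \<le> mu" using assms by simp
  then have "(2 * sqrt r)\<^sup>2 \<le> mu\<^sup>2" using assms by (intro power_mono) auto
  then show ?thesis using assms by (simp add: power_mult_distrib)
qed

text \<open>With a positive determinant, \<open>star_test_vector\<close> would produce a block
  vector whose gain exceeds \<open>m\<close>, and hence \<open>mu\<close>, times its squared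
  norm.\<close>

lemma star_det_le_0:
  assumes "m > 2" "mu \<le> m"
  shows "star_det p q m \<le> 0"
proof (rule ccontr)
  assume "\<not> star_det p q m \<le> 0"
  then have pos: "star_det p q m > 0" by simp
  have nn: "p \<ge> 0" "q \<ge> 0" by (auto simp: p_def q_def)
  show False
  proof (rule star_test_vector[OF assms(1) nn pos])
    fix a b g h e z :: real
    assume 1: "m * (a\<^sup>2 + p * b\<^sup>2 + g\<^sup>2 + h\<^sup>2 + q * z\<^sup>2 + e\<^sup>2)
      < 4 * (a * (p * b + g) + e * (q * z + h) - g * h) - (a + p * b + g - e - q * z - h)\<^sup>2"
    have "mu * (a\<^sup>2 + p * b\<^sup>2 + g\<^sup>2 + h\<^sup>2 + q * z\<^sup>2 + e\<^sup>2) \<le> m * (a\<^sup>2 + p * b\<^sup>2 + g\<^sup>2 + h\<^sup>2 + q * z\<^sup>2 + e\<^sup>2)"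
      using assms(2) nn by (intro mult_right_mono) auto
    then show False using 1 block_gain_le[of a b g e z h] by linarith
  qed
qed

text \<open>The rows of the eigenvalue equation, with signs reversed on \<open>Q\<close>, form the
  system of \<open>star_eigen_system\<close>, where \<open>- x w\<close> and \<open>- x d\<close>
  take the places of \<open>d\<close> and \<open>e\<close>.\<close>

lemma eigen_structure:
  assumes eq: "gain n E x = mu * (\<Sum>i<n. (x i)\<^sup>2)" and mu: "mu > 0"
  shows "x c = (mu + 2) * (x u - x w) / 4" "x d = - (mu + 2) * (x u - x w) / 4"
    and "v \<in> P - {c, u} \<Longrightarrow> x v = x u - 2 * x w / mu"
    and "v \<in> Q - {d, w} \<Longrightarrow> x v = x w - 2 * x u / mu"
    and "(2 * p - (mu\<^sup>2 - 4) / 4) * x u + (4 * p / mu - (mu\<^sup>2 + 4 * mu - 4) / 4) * (- x w) = 0"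
    and "(2 * q - (mu\<^sup>2 - 4) / 4) * (- x w) + (4 * q / mu - (mu\<^sup>2 + 4 * mu - 4) / 4) * x u = 0"
proof -
  define S where "S = (\<Sum>j<n. x j)"
  have lt: "v < n" if "v \<in> P \<union> Q" for v using that PQ by auto
  have row: "mu * x k = 2 * (\<Sum>j\<in>{y. {k, y} \<in> E}. x j) - S" if k: "k \<in> P \<union> Q" for k
  proof -
    have "{j. j < n \<and> {k, j} \<in> E} = {y. {k, y} \<in> E}"
      using E_sub by (auto simp: complete_graph_def doubleton_eq_iff)
    then show ?thesis using gain_eq_eigen[OF n_pos E_sub eq lt[OF k]] by (simp add: S_def)
  qed
  have cd: "c \<noteq> w" "d \<noteq> u" using P Q disj by auto
  have rc: "mu * x c = 2 * (x u + (\<Sum>v\<in>P - {c, u}. x v)) - S"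
    using row[of c] P by (simp add: neighbours sum_split)
  have ru: "mu * x u = 2 * (x c + x w) - S"
    using row[of u] P cd by (simp add: neighbours)
  have rw: "mu * x w = 2 * (x d + x u) - S"
    using row[of w] Q cd by (simp add: neighbours)
  have rd: "mu * x d = 2 * (x w + (\<Sum>v\<in>Q - {d, w}. x v)) - S"
    using row[of d] Q by (simp add: neighbours sum_split)
  have rP: "mu * x v = 2 * x c - S" if "v \<in> P - {c, u}" for v
    using row[of v] neighbours(5)[OF that] that by simp
  have rQ: "mu * x v = 2 * x d - S" if "v \<in> Q - {d, w}" for v
    using row[of v] neighbours(6)[OF that] that by simp
  have BP: "mu * (\<Sum>v\<in>P - {c, u}. x v) = p * (2 * x c - S)"
    using rP by (simp add: sum_distrib_left card_leaves)
  have "mu * (\<Sum>v\<in>Q - {d, w}. x v) = q * (2 * x d - S)"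
    using rQ by (simp add: sum_distrib_left card_leaves)
  then have BQ: "mu * - (\<Sum>v\<in>Q - {d, w}. x v) = q * (2 * (- x d) + S)"
    by (simp add: algebra_simps)
  have sys: "S = x c + x u + (\<Sum>v\<in>P - {c, u}. x v) - (- x d) - (- x w) - (- (\<Sum>v\<in>Q - {d, w}. x v))"
    "mu * x c = 2 * (x u + (\<Sum>v\<in>P - {c, u}. x v)) - S" "mu * x u = 2 * (x c - (- x w)) - S"
    "mu * (- x w) = 2 * (- x d - x u) + S" "mu * (- x d) = 2 * (- x w + - (\<Sum>v\<in>Q - {d, w}. x v)) + S"
    using rc ru rw rd unfolding S_def sum_split(3) by simp_all
  note res = star_eigen_system[OF mu sys BP BQ]
  show xc: "x c = (mu + 2) * (x u - x w) / 4" using res(2) by simp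
  show xd: "x d = - (mu + 2) * (x u - x w) / 4" using res(1) xc by (simp add: algebra_simps)
  show "v \<in> P - {c, u} \<Longrightarrow> x v = x u - 2 * x w / mu"
    using rP[of v] ru mu by (simp add: field_simps)
  show "v \<in> Q - {d, w} \<Longrightarrow> x v = x w - 2 * x u / mu"
    using rQ[of v] rw mu by (simp add: field_simps)
  show "(2 * p - (mu\<^sup>2 - 4) / 4) * x u + (4 * p / mu - (mu\<^sup>2 + 4 * mu - 4) / 4) * (- x w) = 0"
    by (rule res(4))
  show "(2 * q - (mu\<^sup>2 - 4) / 4) * (- x w) + (4 * q / mu - (mu\<^sup>2 + 4 * mu - 4) / 4) * x u = 0"
    by (rule res(5))
qed

end

section \<open>The optimal tree\<close>

lemma finite_attains_max:
  fixes f :: "'a \<Rightarrow> 'b::linorder"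
  assumes "finite A" "A \<noteq> {}"
  shows "\<exists>k\<in>A. \<forall>i\<in>A. f i \<le> f k"
proof -
  obtain k where k: "k \<in> A" "Max (f ` A) = f k" using obtains_MAX[OF assms] by metis
  have "f i \<le> Max (f ` A)" if "i \<in> A" for i using assms(1) that by simp
  then show ?thesis using k by auto
qed

lemma gain_uminus:
  assumes "E \<subseteq> snd (complete_graph n)"
  shows "gain n E (\<lambda>i. - x i) = gain n E x"
proof -
  have "(\<Sum>e\<in>E. prod (\<lambda>i. - x i) e) = (\<Sum>e\<in>E. prod x e)"
  proof (intro sum.cong refl)
    fix e assume "e \<in> E"
    then have "e \<in> snd (complete_graph n)" using assms by blast
    then have "\<exists>a b. a \<noteq> b \<and> e = {a, b}" by (simp add: complete_graph_def) metis
    then obtain a b where "a \<noteq> b" "e = {a, b}" by metis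
    then show "prod (\<lambda>i. - x i) e = prod x e" by simp
  qed
  then show ?thesis by (simp add: gain_def sum_negf)
qed

section \<open>Excluding sign classes with fewer than two vertices\<close>

context
  fixes n :: nat and T :: "nat graph"
  assumes T: "spanning_tree (complete_graph n) T"
begin

private lemma tree: "is_tree T" and vertices: "fst T = {..<n}"
  using T by (auto simp: spanning_tree_def complete_graph_def)

text \<open>With \<open>c\<close> of greatest weight and s the coordinate sum, the star bound leaves
  at most -(s - 2 x_c)^2.\<close>

lemma gain_nonneg_vector_le_0:
  assumes n: "n > 0" and x: "\<And>i. i < n \<Longrightarrow> x i \<ge> 0"
  shows "gain n (snd T) x \<le> 0"
proof -
  obtain c where c: "c < n" "\<And>i. i < n \<Longrightarrow> x i \<le> x c"
    using finite_attains_max[of "{..<n}" x] n by auto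
  have "(\<Sum>e\<in>snd T. prod x e) \<le> x c * (\<Sum>v\<in>{..<n} - {c}. x v)"
  proof (rule forest_weight_le)
    show "acyclic_edges {..<n} (snd T)"
      using tree vertices unfolding is_tree_def acyclic_edges_def by (metis prod.collapse)
    show "\<exists>u\<in>{..<n}. \<exists>v\<in>{..<n}. u \<noteq> v \<and> e = {u, v}" if "e \<in> snd T" for e
      using tree that vertices by (simp add: is_tree_def simple_graph_def)
  qed (use c x in auto)
  moreover have "(\<Sum>v<n. x v) = x c + (\<Sum>v\<in>{..<n} - {c}. x v)" using c by (intro sum.remove) auto
  ultimately have "gain n (snd T) x \<le> 4 * (x c * ((\<Sum>v<n. x v) - x c)) - (\<Sum>v<n. x v)\<^sup>2"
    by (simp add: gain_def)
  also have "\<dots> = - ((\<Sum>v<n. x v) - 2 * x c)\<^sup>2" by (simp add: power2_eq_square algebra_simps)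
  finally show ?thesis using zero_le_power2[of "(\<Sum>v<n. x v) - 2 * x c"] by linarith
qed

text \<open>A double star needs two vertices on each side. A class with the single vertex
  \<open>c\<close> is ruled out by the star bound on the other vertices together with
  Cauchy-Schwarz, once m^2 + m > n - 1.\<close>

lemma gain_single_positive_less:
  assumes n: "n \<ge> 2" and c: "c < n" "x c \<ge> 0" and x: "\<And>i. i < n \<Longrightarrow> i \<noteq> c \<Longrightarrow> x i \<le> 0"
    and m: "m > 0" "m\<^sup>2 + m > real n - 1" and nz: "(\<Sum>i<n. (x i)\<^sup>2) \<noteq> 0"
  shows "gain n (snd T) x < m * (\<Sum>i<n. (x i)\<^sup>2)"
proof -
  let ?Q = "{..<n} - {c}"
  have "card ?Q > 0" using c n by simp
  then have Q: "finite ?Q" "?Q \<noteq> {}" by (simp, metis card.empty less_irrefl)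
  obtain d where d: "d \<in> ?Q" "\<And>i. i \<in> ?Q \<Longrightarrow> x d \<le> x i"
    using finite_attains_max[OF Q, of "\<lambda>i. - x i"] by auto
  obtain w where w: "w \<in> ?Q" "\<And>i. i \<in> ?Q \<Longrightarrow> x i \<le> x w"
    using finite_attains_max[OF Q, of x] by auto
  define s where "s = - (\<Sum>v\<in>?Q. x v)"
  define R where "R = (\<Sum>v\<in>?Q. (x v)\<^sup>2)"
  define M where "M = x c"
  have xQ: "x v \<le> 0" if "v \<in> ?Q" for v using x that by auto
  \<comment> \<open>Here \<open>P\<close> is \<open>{c}\<close>, so \<open>c\<close> serves both as
    centre and as end of the crossing edge.\<close>
  have "(\<Sum>e\<in>snd T. prod x e) \<le> x c * (\<Sum>v\<in>{c} - {c}. x v) + x d * (\<Sum>v\<in>?Q - {d}. x v) + x c * x w"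
    by (rule tree_weight_two_signs_le[OF tree]) (use vertices c d w xQ in auto)
  also have "\<dots> \<le> x d * (\<Sum>v\<in>?Q - {d}. x v)"
    using c(2) xQ[OF w(1)] by (simp add: mult_nonneg_nonpos)
  also have "(\<Sum>v\<in>?Q - {d}. x v) = - s - x d"
    using sum.remove[OF Q(1) d(1), of x] by (simp add: s_def)
  finally have W: "(\<Sum>e\<in>snd T. prod x e) \<le> x d * (- s - x d)" .
  have S: "(\<Sum>v<n. x v) = M - s" "(\<Sum>v<n. (x v)\<^sup>2) = M\<^sup>2 + R"
    using c sum.remove[of "{..<n}" c x] sum.remove[of "{..<n}" c "\<lambda>v. (x v)\<^sup>2"]
    by (simp_all add: s_def M_def R_def)
  have "gain n (snd T) x \<le> 4 * (x d * (- s - x d)) - (M - s)\<^sup>2"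
    using W by (simp add: gain_def S)
  also have "\<dots> = 2 * M * s - M\<^sup>2 - (s + 2 * x d)\<^sup>2" by (simp add: power2_eq_square algebra_simps)
  finally have g: "gain n (snd T) x \<le> 2 * M * s - M\<^sup>2"
    using zero_le_power2[of "s + 2 * x d"] by linarith
  \<comment> \<open>Cauchy-Schwarz over the n - 1 vertices of \<open>?Q\<close>.\<close>
  have "s\<^sup>2 \<le> R * (real n - 1)"
    using sum_squared_le_sum_of_squares[of x ?Q] c n by (simp add: s_def R_def of_nat_diff)
  have "2 * M * s - M\<^sup>2 < m * (M\<^sup>2 + R)"
  proof (cases "R = 0")
    case True
    then have "s = 0" using \<open>s\<^sup>2 \<le> R * (real n - 1)\<close> by simp
    moreover have "M\<^sup>2 > 0" using nz True S(2) by simp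
    moreover have "m * M\<^sup>2 > 0" using m(1) \<open>M\<^sup>2 > 0\<close> by simp
    moreover have "- M\<^sup>2 < m * M\<^sup>2" using calculation(2,3) by linarith
    ultimately show ?thesis using True by simp
  next
    case False
    have "R \<ge> 0" by (simp add: R_def sum_nonneg)
    then have "R > 0" using False by simp
    then have "s\<^sup>2 < R * (m\<^sup>2 + m)"
      \<comment> \<open>Strictness comes from \<open>R > 0\<close>, which is why
        \<open>R = 0\<close> is a separate case.\<close>
      using \<open>s\<^sup>2 \<le> R * (real n - 1)\<close> m(2) by (smt (verit) mult_strict_left_mono)
    then have "0 < ((m + 1) * M - s)\<^sup>2 + (R * (m\<^sup>2 + m) - s\<^sup>2)"
      by (simp add: add_nonneg_pos)
    also have "\<dots> = (m + 1) * (m * (M\<^sup>2 + R) - (2 * M * s - M\<^sup>2))"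
      by (simp add: power2_eq_square algebra_simps)
    finally show ?thesis using m(1) by (simp add: zero_less_mult_iff)
  qed
  then show ?thesis using g S(2) by simp
qed

end

text \<open>With k = n div 2 and r = n mod 2, sizes k - t and k + r + t lose t (r + t) in the
  product compared with k and k + r.\<close>

lemma balanced_product_max:
  fixes a b n :: nat
  assumes "a + b = n"
  shows "a = (n + 1) div 2 \<and> b = n div 2 \<or> a = n div 2 \<and> b = (n + 1) div 2
    \<or> a * b < ((n + 1) div 2) * (n div 2)"
proof -
  define r where "r = n mod 2"
  have n: "n = 2 * (n div 2) + r" "(n + 1) div 2 = n div 2 + r" "r < 2"
    unfolding r_def by presburger+
  define k where "k = n div 2"
  consider "a < k" | "b < k" | "k \<le> a" "k \<le> b" by linarith
  then show ?thesis
  proof cases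
    case 1
    then obtain t where t: "k = a + t" "t > 0" by (metis less_imp_add_positive)
    then have "b = k + r + t" using assms n by (simp add: k_def)
    then have "a * b < (k + r) * k" using t by (simp add: algebra_simps)
    then show ?thesis using n by (simp add: k_def)
  next
    case 2
    then obtain t where t: "k = b + t" "t > 0" by (metis less_imp_add_positive)
    then have "a = k + r + t" using assms n by (simp add: k_def)
    then have "a * b < (k + r) * k" using t by (simp add: algebra_simps)
    then show ?thesis using n by (simp add: k_def)
  next
    case 3
    then have "a = k \<and> b = k + r \<or> b = k \<and> a = k + r" using assms n by (auto simp: k_def)
    then show ?thesis using n by (auto simp: k_def)
  qed
qed

text \<open>These are the weights from \<open>eigen_structure\<close>, in absolute value: on each
  side the joined leaf comes first, then the free leaves, then the centre.\<close>

lemma star_eigenvector_ordering: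
  fixes m g h :: real
  assumes "m > 2" "g > 0" "h > 0"
  shows "g < g + 2 * h / m" "g + 2 * h / m < (m + 2) * (g + h) / 4"
proof -
  show "g < g + 2 * h / m" using assms by simp
  have "2 * h / m < h" using assms by (simp add: field_simps)
  moreover have "4 * (g + h) < (m + 2) * (g + h)" using assms by (intro mult_strict_right_mono) auto
  ultimately show "g + 2 * h / m < (m + 2) * (g + h) / 4" by argo
qed

theorem theorem2:
  fixes n :: nat and T :: "nat graph"
  assumes "n \<ge> 6"
    and "spanning_tree (complete_graph n) T"
    and "\<not> balanced (signed_complete n T)"
    and "\<And>T'. spanning_tree (complete_graph n) T' \<Longrightarrow> \<not> balanced (signed_complete n T') \<Longrightarrow>
           least_eigenvalue (adjacency_matrix (signed_complete n T))
             \<le> least_eigenvalue (adjacency_matrix (signed_complete n T'))"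
  shows "graph_iso T (joined_stars (nat \<lceil>real n / 2\<rceil> - 1) (nat \<lfloor>real n / 2\<rfloor> - 1))"
proof -
  define a b where "a = (n + 1) div 2" and "b = n div 2"
  have ab: "a + b = n" "a \<ge> 3" "b \<ge> 3" "a \<ge> b" "a \<le> b + 1" using assms(1) by (auto simp: a_def b_def)
  have ceil: "nat \<lceil>real n / 2\<rceil> = a" "nat \<lfloor>real n / 2\<rfloor> = b"
    unfolding a_def b_def by linarith+
  define m where "m = gain_bound n T"
  have tree: "is_tree T" and verts: "fst T = {0..<n}"
    using assms(2) by (auto simp: spanning_tree_def complete_graph_def)
  have sub: "snd T \<subseteq> snd (complete_graph n)" using assms(2) by (rule spanning_tree_edges)
  have n0: "n > 0" using assms(1) by simp
  have max: "gain_bound n (double_star P c u Q d w) \<le> m" if "spanning_double_star P c u Q d w n"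
    for P c u Q d w
  proof -
    interpret spanning_double_star P c u Q d w n by fact
    show ?thesis
      using assms(4)[OF double_star_unbalanced_spanning[OF double_star_data_axioms PQ]]
      by (simp add: m_def gain_bound_def)
  qed
  \<comment> \<open>The balanced double star, against which the optimal tree is compared.\<close>
  interpret B: spanning_double_star "{0..<a}" 0 1 "{a..<n}" a "a + 1" n
    using ab by unfold_locales auto
  have B: "B.p = real a - 2" "B.q = real b - 2" "B.mu \<le> m"
    using ab max[OF B.spanning_double_star_axioms] by (auto simp: B.p_def B.q_def of_nat_diff)
  have m2: "m > 2" using B.mu_gt_2 B ab by simp
  \<comment> \<open>Together with m > 2 this gives m^2 + m > 4b - 6 \<ge> 2b \<ge> n - 1, as b \<ge>
    3.\<close>
  have "4 * (real b - 2) \<le> B.mu\<^sup>2" using ab by (intro B.mu_square_ge) (auto simp: B)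
  also have "\<dots> \<le> m\<^sup>2" using B.mu_gt_2 B ab by (intro power_mono) auto
  finally have "4 * (real b - 2) \<le> m\<^sup>2" .
  moreover have "real n \<le> 2 * real b + 1" "real b \<ge> 3" using ab by linarith+
  moreover have "m\<^sup>2 > 2\<^sup>2" using m2 by (intro power_strict_mono) auto
  ultimately have mn: "m\<^sup>2 + m > real n - 1" using m2 by (simp add: algebra_simps)
  obtain x where x: "gain n (snd T) x = m * (\<Sum>i<n. (x i)\<^sup>2)" "(\<Sum>i<n. (x i)\<^sup>2) = 1"
    using gain_attained[OF n0 sub] unfolding m_def by metis
  have pos: "gain n (snd T) x > 0" using x m2 by simp
  have negx: "gain n (snd T) (\<lambda>i. - x i) = gain n (snd T) x" "(\<Sum>i<n. (- x i)\<^sup>2) = 1"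
    using gain_uminus[OF sub] x by simp_all
  \<comment> \<open>Zero weights go to \<open>P\<close>. So weights on \<open>Q\<close> are strictly
    negative at once, while positivity on \<open>P\<close> has to wait for
    \<open>xu\<close>.\<close>
  define P Q where "P = {i. i < n \<and> x i \<ge> 0}" and "Q = {i. i < n \<and> x i < 0}"
  have PQ: "P \<union> Q = {0..<n}" "P \<inter> Q = {}" "finite P" "finite Q" by (auto simp: P_def Q_def)
  have cPQ: "card P + card Q = n" using card_Un_disjoint[OF PQ(3,4,2)] PQ(1) by simp
  have "\<exists>i<n. \<not> x i \<ge> 0"
    using gain_nonneg_vector_le_0[OF assms(2) n0, of x] pos by force
  then have "Q \<noteq> {}" by (auto simp: Q_def)
  have "\<exists>i<n. \<not> - x i \<ge> 0"
    using gain_nonneg_vector_le_0[OF assms(2) n0, of "\<lambda>i. - x i"] pos negx by force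
  then have "P \<noteq> {}" by (auto simp: P_def)
  have "card P \<noteq> 1"
  proof
    assume "card P = 1"
    then obtain c where c: "P = {c}" by (auto simp: card_1_singleton_iff)
    have "gain n (snd T) x < m * (\<Sum>i<n. (x i)\<^sup>2)"
    proof (rule gain_single_positive_less[OF assms(2)])
      show "c < n" "0 \<le> x c" using c by (auto simp: P_def)
      show "x i \<le> 0" if "i < n" "i \<noteq> c" for i using that c by (force simp: P_def)
    qed (use assms(1) m2 mn x in auto)
    then show False using x by simp
  qed
  moreover have "card Q \<noteq> 1"
  proof
    assume "card Q = 1"
    then obtain c where c: "Q = {c}" by (auto simp: card_1_singleton_iff)
    have "gain n (snd T) (\<lambda>i. - x i) < m * (\<Sum>i<n. (- x i)\<^sup>2)"
    proof (rule gain_single_positive_less[OF assms(2)])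
      have "c \<in> Q" using c by simp
      then show "c < n" "0 \<le> - x c" by (auto simp: Q_def)
      show "- x i \<le> 0" if "i < n" "i \<noteq> c" for i using that c by (force simp: Q_def)
    qed (use assms(1) m2 mn x in auto)
    then show False using x negx by simp
  qed
  moreover have "card P \<noteq> 0" "card Q \<noteq> 0" using \<open>P \<noteq> {}\<close> \<open>Q \<noteq> {}\<close> PQ by simp_all
  ultimately have card2: "card P \<ge> 2" "card Q \<ge> 2" by linarith+
  have ne: "A - {k} \<noteq> {}" if "card A \<ge> 2" for A :: "nat set" and k
  proof
    assume "A - {k} = {}"
    then have "card A \<le> card {k}" by (intro card_mono) auto
    then show False using that by simp
  qed
  obtain c where c: "c \<in> P" "\<And>i. i \<in> P \<Longrightarrow> x i \<le> x c" using finite_attains_max[of P x] PQ \<open>P \<noteq> {}\<close> by blast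
  \<comment> \<open>Choosing from \<open>P - {c}\<close> keeps \<open>u\<close> different from
    \<open>c\<close> even under ties; \<open>u\<close> is still least on all of \<open>P\<close>
    because \<open>c\<close> is greatest.\<close>
  obtain u where u: "u \<in> P - {c}" "\<And>i. i \<in> P - {c} \<Longrightarrow> x u \<le> x i"
    using finite_attains_max[of "P - {c}" "\<lambda>i. - x i", unfolded neg_le_iff_le] PQ ne[OF card2(1)] by blast
  obtain d where d: "d \<in> Q" "\<And>i. i \<in> Q \<Longrightarrow> x d \<le> x i"
    using finite_attains_max[of Q "\<lambda>i. - x i", unfolded neg_le_iff_le] PQ \<open>Q \<noteq> {}\<close> by blast
  obtain w where w: "w \<in> Q - {d}" "\<And>i. i \<in> Q - {d} \<Longrightarrow> x i \<le> x w"
    using finite_attains_max[of "Q - {d}" x] PQ ne[OF card2(2)] by blast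
  have umin: "x u \<le> x i" if "i \<in> P" for i using c u that by (cases "i = c") auto
  have wmax: "x i \<le> x w" if "i \<in> Q" for i using d w that by (cases "i = d") auto
  interpret D: spanning_double_star P c u Q d w n
    using PQ c u d w by unfold_locales auto
  have vT: "fst T = P \<union> Q" using verts PQ by simp
  have P0: "0 \<le> x i \<and> x u \<le> x i \<and> x i \<le> x c" if "i \<in> P" for i
    using that c umin by (auto simp: P_def)
  have Q0: "x i \<le> 0 \<and> x i \<le> x w \<and> x d \<le> x i" if "i \<in> Q" for i
    using that d wmax by (auto simp: Q_def)
  have cu: "c \<in> P" "u \<in> P" "d \<in> Q" "w \<in> Q" using c u d w by auto
  \<comment> \<open>The chain from \<open>gain n (snd T) x\<close> through
    \<open>gain n D.E x\<close> and \<open>D.mu\<close> to \<open>m\<close> starts and ends at the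
    same value, so \<open>x\<close> is extremal for the double star as well.\<close>
  have "gain n (snd T) x \<le> gain n D.E x"
    using tree_weight_two_signs_le[OF tree vT PQ(2) P0 Q0 cu] by (simp add: gain_def D.weight)
  moreover have "gain n D.E x \<le> D.mu * (\<Sum>i<n. (x i)\<^sup>2)" by (rule gain_le[OF n0 D.E_sub])
  moreover have "D.mu \<le> m" by (rule max[OF D.spanning_double_star_axioms])
  ultimately have Dmu: "D.mu = m" and gD: "gain n D.E x = gain n (snd T) x" using x by simp_all
  have "gain n D.E x = D.mu * (\<Sum>i<n. (x i)\<^sup>2)" using gD x Dmu by simp
  then have eq: "gain n D.E x = D.mu * (\<Sum>i<n. (x i)\<^sup>2)" "D.mu > 0" using Dmu m2 by simp_all
  note es = D.eigen_structure[OF eq, unfolded Dmu]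
  have xw: "- x w > 0" using cu(4) by (simp add: Q_def)
  \<comment> \<open>The reduced equations have the solution \<open>x u\<close>,
    \<open>- x w\<close>, which is nontrivial because \<open>x w\<close> is negative.\<close>
  have "star_det D.p D.q m = 0"
    using two_by_two_det_zero[OF es(5) es(6)] xw unfolding star_det_def by simp
  moreover have "star_det B.p B.q m \<le> 0" by (rule B.star_det_le_0[OF m2 B(3)])
  moreover have Dpq: "D.p = real (card P) - 2" "D.q = real (card Q) - 2"
    using card2 by (auto simp: D.p_def D.q_def of_nat_diff)
  moreover have cPQr: "real (card P) + real (card Q) = real a + real b" using cPQ ab by linarith
  \<comment> \<open>Both double stars have equally many free leaves, so a larger product would make
    the determinant of the balanced one positive at \<open>m\<close>.\<close>
  ultimately have "\<not> D.p * D.q < B.p * B.q"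
    using star_det_less[OF m2, of B.p B.q D.p D.q] by (auto simp: B)
  moreover have "B.p * B.q - D.p * D.q = real a * real b - real (card P) * real (card Q)"
    using cPQr unfolding B Dpq by (simp add: algebra_simps)
  ultimately have "\<not> card P * card Q < a * b"
    by (metis diff_gt_0_iff_gt of_nat_less_iff of_nat_mult)
  then have bal: "card P = a \<and> card Q = b \<or> card P = b \<and> card Q = a"
    using balanced_product_max[OF cPQ] by (auto simp: a_def b_def)
  \<comment> \<open>Whichever side is the larger one, the balanced sizes differ by at most
    1.\<close>
  have "x u \<noteq> 0"
  proof (rule star_eigen_first_nonzero[OF m2 _ xw es(5,6)])
    show "D.p \<le> D.q + 1" using bal ab Dpq by auto
  qed
  then have xu: "x u > 0" using P0[OF cu(2)] by simp
  have "- (m + 2) * (x u - x w) / 4 = - ((m + 2) * (- x w + x u) / 4)" by (simp add: field_simps)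
  then have xcd: "x c = (m + 2) * (x u + - x w) / 4" "- x d = (m + 2) * (- x w + x u) / 4"
    using es(1,2) by simp_all
  note ordu = star_eigenvector_ordering[OF m2 xu xw] and ordw = star_eigenvector_ordering[OF m2 xw xu]
  have ordP: "x u < x v" "x v < x c" if "v \<in> P - {c, u}" for v
  proof -
    have "x v = x u + 2 * - x w / m" using es(3)[OF that] by simp
    then show "x u < x v" "x v < x c" using ordu xcd(1) by metis+
  qed
  have ordQ: "x v < x w" "x d < x v" if "v \<in> Q - {d, w}" for v
  proof -
    have "- x v = - x w + 2 * x u / m" using es(4)[OF that] by simp
    then have "- x w < - x v" "- x v < - x d" using ordw xcd(2) by metis+
    then show "x v < x w" "x d < x v" by simp_all
  qed
  have "x u < x c" using ordu xcd(1) by (metis less_trans)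
  moreover have "- x w < - x d" using ordw xcd(2) by (metis less_trans)
  ultimately have uc: "x u < x c" "x d < x w" by simp_all
  have "T = double_star P c u Q d w"
  proof (rule tree_weight_two_signs_eq[OF tree vT PQ(2) P0 Q0 cu])
    show "(\<Sum>e\<in>snd T. prod x e) = x c * (\<Sum>v\<in>P - {c}. x v) + x d * (\<Sum>v\<in>Q - {d}. x v) + x u * x w"
      using gD by (simp add: gain_def D.weight)
    show "x v < x c" if "v \<in> P - {c}" for v using ordP uc that by (cases "v = u") auto
    show "x u < x v" if "v \<in> P - {u}" for v using ordP uc that by (cases "v = c") auto
    show "x d < x v" if "v \<in> Q - {d}" for v using ordQ uc that by (cases "v = w") auto
    show "x v < x w" if "v \<in> Q - {w}" for v using ordQ uc that by (cases "v = d") auto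
  qed (use xu xw in auto)
  moreover have "graph_iso (double_star P c u Q d w) (joined_stars (a - 1) (b - 1))"
    using bal
  proof
    assume "card P = a \<and> card Q = b"
    then show ?thesis using D.iso_joined_stars by simp
  next
    \<comment> \<open>The larger class may be \<open>Q\<close>; then the two sides are
      exchanged.\<close>
    assume "card P = b \<and> card Q = a"
    then show ?thesis
      using double_star_data.iso_joined_stars[OF D.swap] by (simp add: double_star_swap)
  qed
  ultimately show ?thesis by (simp add: ceil)
qed

end
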